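(* Let $F=Z^n+\sum_{k=0}^{n-2}a_k(X,Y)Z^k$ be a WT equation with $\overline F=Z^n$. Following the algorithm described in the context (with any choice of directions, and as long as the multiplicity does not drop), in a finite number of steps we arrive at a surface with a defining equation $G$ such that every $\Gamma[k](G)$, $k=0,\dots,n-2$, is a generalized quadrant.
   Context: $K$ is an algebraically closed field of characteristic $0$ and $\nu$ is the usual order function on power series. An embedded algebroid surface of multiplicity $n>1$ is $\mathcal S=\mathrm{Spec}(K[[X,Y,Z]]/(F))$ with $\nu(F)=n$; $F$ is called an equation of $\mathcal S$ and $\overline F$ is its initial form. A Weierstrass-Tchirnhausen (WT) equation is $F=Z^n+\sum_{k=0}^{n-2}a_k(X,Y)Z^k$ with $a_k=\sum_{i,j} a_{ijk}X^iY^j\in K[[X,Y]]$, $\nu(a_k)\ge n-k$. $\Gamma[k](F)$ is the Newton polyhedron of $a_k$: the convex hull of $\bigcup_{a_{ijk}\neq0}((i,j)+\mathbb Z_{\ge0}^2)$. It is a quadrant if it has only one vertex; the empty set is also considered a quadrant. A transvection is a change of coordinates $X\mapsto X$, $Y\mapsto Y+\sum_{i\ge1}\alpha_iX^i$, $Z\mapsto Z$ with $\alpha_i\in K$. $\Gamma[k](F)$ is a generalized quadrant if there is a transvection $\varphi$ such that $\Gamma[k](\varphi(F))$ is a quadrant. A non-maximal prime ideal $\mathfrak p=(G,H)$ with $\nu(G)=\nu(H)=1$ is a permissible curve if $F\in\mathfrak p^n$. Algorithm: if $(Z,X)$ or $(Z,Y)$ is a permissible curve, make a monoidal transformation centered in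 it; otherwise perform a quadratic transformation. A quadratic transformation in the direction $(a:b:c)$ (a point of the tangent cone $\overline F=0$ in $\mathbb P^2(K)$) is given, say for $a\neq0$, by $X\mapsto X$, $Y\mapsto X(Y+b/a)$, $Z\mapsto X(Z+c/a)$, the new equation being the image of $F$ divided by $X^n$; in the direction $(0:1:0)$ by $X\mapsto XY$, $Y\mapsto Y$, $Z\mapsto YZ$, dividing by $Y^n$ (other directions with $b\ne0$ analogously). A monoidal transformation centered in $(Z,X)$ in the direction $(a:0:c)$, $a\ne0$, is $X\mapsto X$, $Y\mapsto Y$, $Z\mapsto X(Z+c/a)$, dividing by $X^n$; symmetrically for $(Z,Y)$. *)

theory Defs
  imports "HOL-Analysis.Analysis" "HOL-Computational_Algebra.Computational_Algebra"
begin

section \<open>Power series in two and three variables\<close>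

text \<open>
  \<open>K[[X,Y]]\<close> is \<open>(K[[X]])[[Y]]\<close> and \<open>K[[X,Y,Z]]\<close> is \<open>((K[[X]])[[Y]])[[Z]]\<close>: the outermost
  fps variable is the last one. In particular, for \<open>F\<close> in \<open>K[[X,Y,Z]]\<close> the series
  \<open>fps_nth F k\<close> in \<open>K[[X,Y]]\<close> is the coefficient of \<open>Z^k\<close> in \<open>F\<close>.
\<close>

type_synonym 'a ps2 = "'a fps fps"
type_synonym 'a ps3 = "'a fps fps fps"

definition coeff2 :: "'a::zero ps2 \<Rightarrow> nat \<Rightarrow> nat \<Rightarrow> 'a" where
  "coeff2 f i j = fps_nth (fps_nth f j) i"

definition coeff3 :: "'a::zero ps3 \<Rightarrow> nat \<Rightarrow> nat \<Rightarrow> nat \<Rightarrow> 'a" where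
  "coeff3 F i j k = coeff2 (fps_nth F k) i j"

definition Abs_ps3 :: "(nat \<Rightarrow> nat \<Rightarrow> nat \<Rightarrow> 'a::zero) \<Rightarrow> 'a ps3" where
  "Abs_ps3 f = Abs_fps (\<lambda>k. Abs_fps (\<lambda>j. Abs_fps (\<lambda>i. f i j k)))"

lemma coeff3_Abs_ps3 [simp]: "coeff3 (Abs_ps3 f) i j k = f i j k"
  by (simp add: coeff3_def coeff2_def Abs_ps3_def)

abbreviation const3 :: "'a::zero \<Rightarrow> 'a ps3" where
  "const3 c \<equiv> fps_const (fps_const (fps_const c))"

abbreviation varX :: "'a::{zero,one} ps3" where
  "varX \<equiv> fps_const (fps_const fps_X)"

abbreviation varY :: "'a::{zero,one} ps3" where
  "varY \<equiv> fps_const fps_X"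

abbreviation varZ :: "'a::{zero,one} ps3" where
  "varZ \<equiv> fps_X"

text \<open>The order function; the order of \<open>0\<close> is \<open>\<infinity>\<close>.\<close>

definition ord2 :: "'a::zero ps2 \<Rightarrow> enat" where
  "ord2 f = Inf {enat (i + j) | i j. coeff2 f i j \<noteq> 0}"

definition ord3 :: "'a::zero ps3 \<Rightarrow> enat" where
  "ord3 F = Inf {enat (i + j + k) | i j k. coeff3 F i j k \<noteq> 0}"

text \<open>The initial form is only meaningful for \<open>F \<noteq> 0\<close>.\<close>

definition initial_form :: "'a::zero ps3 \<Rightarrow> 'a ps3" where
  "initial_form F =
     Abs_ps3 (\<lambda>i j k. if enat (i + j + k) = ord3 F then coeff3 F i j k else 0)"

text \<open>The point \<open>(a:b:c)\<close> of the projective plane is on the curve \<open>initial_form F = 0\<close>.\<close>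

definition on_tangent_cone :: "'a::comm_ring_1 ps3 \<Rightarrow> 'a \<Rightarrow> 'a \<Rightarrow> 'a \<Rightarrow> bool" where
  "on_tangent_cone F a b c \<longleftrightarrow>
     (a, b, c) \<noteq> (0, 0, 0) \<and>
     (\<Sum>(i, j, k) \<in> {(i, j, k). enat (i + j + k) = ord3 F}.
        coeff3 (initial_form F) i j k * a ^ i * b ^ j * c ^ k) = 0"

text \<open>
  \<open>subst3 F A B C\<close> is the image of \<open>F\<close> under \<open>X \<mapsto> A\<close>, \<open>Y \<mapsto> B\<close>, \<open>Z \<mapsto> C\<close>, for \<open>A\<close>, \<open>B\<close>, \<open>C\<close>
  without constant term (the only case in which it is used). Then \<open>A^i * B^j * C^k\<close> has order
  at least \<open>i + j + k\<close>, so the finite sum below contains all contributions to the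
  coefficient of \<open>X^p * Y^q * Z^r\<close>. The library's \<open>fps_compose\<close> does not apply, since e.g.
  \<open>X * (Y + b)\<close>, as a power series in \<open>Y\<close> alone, has a nonzero constant term.
\<close>

definition subst3 :: "'a::comm_ring_1 ps3 \<Rightarrow> 'a ps3 \<Rightarrow> 'a ps3 \<Rightarrow> 'a ps3 \<Rightarrow> 'a ps3" where
  "subst3 F A B C =
     Abs_ps3 (\<lambda>p q r. \<Sum>(i, j, k) \<in> {(i, j, k). i + j + k \<le> p + q + r}.
       coeff3 F i j k * coeff3 (A ^ i * B ^ j * C ^ k) p q r)"


section \<open>Weierstrass-Tchirnhausen equations and Newton polyhedra\<close>

definition WT_equation :: "nat \<Rightarrow> 'a::comm_ring_1 ps3 \<Rightarrow> bool" where
  "WT_equation n F \<longleftrightarrow>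
     (\<exists>a :: nat \<Rightarrow> 'a ps2.
        F = varZ ^ n + (\<Sum>k\<le>n - 2. fps_const (a k) * varZ ^ k) \<and>
        (\<forall>k\<le>n - 2. ord2 (a k) \<ge> enat (n - k)))"

definition newton_polyhedron :: "'a::zero ps2 \<Rightarrow> (real \<times> real) set" where
  "newton_polyhedron f =
     convex hull {(real (i + u), real (j + v)) | i j u v. coeff2 f i j \<noteq> 0}"

definition Gam :: "nat \<Rightarrow> 'a::zero ps3 \<Rightarrow> (real \<times> real) set" where
  "Gam k F = newton_polyhedron (fps_nth F k)"

definition quadrant :: "(real \<times> real) set \<Rightarrow> bool" where
  "quadrant P \<longleftrightarrow> P = {} \<or> (\<exists>!v. v extreme_point_of P)"

text \<open>The transvection \<open>Y \<mapsto> Y + h(X)\<close>, where \<open>h\<close> in \<open>K[[X]]\<close> has no constant term.\<close>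

definition transvection :: "'a::comm_ring_1 fps \<Rightarrow> 'a ps3 \<Rightarrow> 'a ps3" where
  "transvection h F = subst3 F varX (varY + fps_const (fps_const h)) varZ"

definition generalized_quadrant :: "nat \<Rightarrow> 'a::comm_ring_1 ps3 \<Rightarrow> bool" where
  "generalized_quadrant k F \<longleftrightarrow>
     (\<exists>h. fps_nth h 0 = 0 \<and> quadrant (Gam k (transvection h F)))"


section \<open>Permissible curves\<close>

text \<open>Ideals of a commutative ring are its submodules, as a module over itself.\<close>

lemma module_self: "module ((*) :: 'a::comm_ring_1 \<Rightarrow> 'a \<Rightarrow> 'a)"
  by unfold_locales (simp_all add: algebra_simps)

definition is_ideal :: "'a::comm_ring_1 set \<Rightarrow> bool" where
  "is_ideal I \<longleftrightarrow> module.subspace (*) I"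

definition ideal_generated :: "'a::comm_ring_1 set \<Rightarrow> 'a set" where
  "ideal_generated S = module.span (*) S"

definition prime_ideal :: "'a::comm_ring_1 set \<Rightarrow> bool" where
  "prime_ideal I \<longleftrightarrow>
     is_ideal I \<and> I \<noteq> UNIV \<and> (\<forall>a b. a * b \<in> I \<longrightarrow> a \<in> I \<or> b \<in> I)"

definition maximal_ideal :: "'a::comm_ring_1 set \<Rightarrow> bool" where
  "maximal_ideal I \<longleftrightarrow>
     is_ideal I \<and> I \<noteq> UNIV \<and> (\<forall>J. is_ideal J \<and> I \<subseteq> J \<longrightarrow> J = I \<or> J = UNIV)"

definition ideal_power :: "'a::comm_ring_1 set \<Rightarrow> nat \<Rightarrow> 'a set" where
  "ideal_power I n = ideal_generated {\<Prod>i<n. f i | f. \<forall>i<n. f i \<in> I}"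

definition permissible_curve :: "nat \<Rightarrow> 'a::comm_ring_1 ps3 \<Rightarrow> 'a ps3 set \<Rightarrow> bool" where
  "permissible_curve n F P \<longleftrightarrow>
     prime_ideal P \<and> \<not> maximal_ideal P \<and>
     (\<exists>G H. ord3 G = 1 \<and> ord3 H = 1 \<and> P = ideal_generated {G, H}) \<and>
     F \<in> ideal_power P n"


section \<open>The algorithm\<close>

text \<open>
  In the relations below \<open>n\<close> is the multiplicity of \<open>F\<close> and \<open>G\<close> is the new equation: as
  \<open>K[[X,Y,Z]]\<close> is a domain, it is determined by \<open>F\<close>, the centre and the direction.
  The first chart has priority: the second one is used only if \<open>a = 0\<close>. The direction
  \<open>(0:0:1)\<close> is never on the tangent cone of a WT equation of multiplicity \<open>n\<close>, since the
  coefficient of \<open>Z^n\<close> in its initial form is \<open>1\<close>.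
\<close>

inductive quadratic_transformation :: "nat \<Rightarrow> 'a::field ps3 \<Rightarrow> 'a ps3 \<Rightarrow> bool"
  for n F G where
  quadratic_X:
    "\<lbrakk>on_tangent_cone F a b c; a \<noteq> 0;
      subst3 F varX (varX * (varY + const3 (b / a))) (varX * (varZ + const3 (c / a)))
        = varX ^ n * G\<rbrakk>
     \<Longrightarrow> quadratic_transformation n F G"
| quadratic_Y:
    "\<lbrakk>on_tangent_cone F 0 b c; b \<noteq> 0;
      subst3 F (varX * varY) varY (varY * (varZ + const3 (c / b))) = varY ^ n * G\<rbrakk>
     \<Longrightarrow> quadratic_transformation n F G"

inductive monoidal_transformation_ZX :: "nat \<Rightarrow> 'a::field ps3 \<Rightarrow> 'a ps3 \<Rightarrow> bool"
  for n F G where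
    "\<lbrakk>on_tangent_cone F a 0 c; a \<noteq> 0;
      subst3 F varX varY (varX * (varZ + const3 (c / a))) = varX ^ n * G\<rbrakk>
     \<Longrightarrow> monoidal_transformation_ZX n F G"

inductive monoidal_transformation_ZY :: "nat \<Rightarrow> 'a::field ps3 \<Rightarrow> 'a ps3 \<Rightarrow> bool"
  for n F G where
    "\<lbrakk>on_tangent_cone F 0 b c; b \<noteq> 0;
      subst3 F varX varY (varY * (varZ + const3 (c / b))) = varY ^ n * G\<rbrakk>
     \<Longrightarrow> monoidal_transformation_ZY n F G"

inductive algorithm_step :: "nat \<Rightarrow> 'a::field ps3 \<Rightarrow> 'a ps3 \<Rightarrow> bool"
  for n F G where
  monoidal_ZX:
    "\<lbrakk>permissible_curve n F (ideal_generated {varZ, varX}); monoidal_transformation_ZX n F G\<rbrakk>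
     \<Longrightarrow> algorithm_step n F G"
| monoidal_ZY:
    "\<lbrakk>permissible_curve n F (ideal_generated {varZ, varY}); monoidal_transformation_ZY n F G\<rbrakk>
     \<Longrightarrow> algorithm_step n F G"
| quadratic:
    "\<lbrakk>\<not> permissible_curve n F (ideal_generated {varZ, varX});
      \<not> permissible_curve n F (ideal_generated {varZ, varY});
      quadratic_transformation n F G\<rbrakk>
     \<Longrightarrow> algorithm_step n F G"

end

theory Submission
  imports Defs
begin

text \<open>
  Write \<open>a_k\<close> for the coefficient of \<open>Z^k\<close>. In a step of the algorithm \<open>Z\<close> goes to \<open>E (Z + c)\<close>, where
  \<open>E\<close> is \<open>X\<close> or \<open>Y\<close>, and the new equation has the coefficient \<open>n c\<close> at \<open>Z^(n-1)\<close>. As the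
  multiplicity is still \<open>n \<ge> 2\<close> and the characteristic is \<open>0\<close>, this forces \<open>c = 0\<close>. Hence all
  equations are WT equations, and the \<open>a_k\<close> evolve independently of each other: with \<open>e = n - k > 0\<close>,
  each step is a substitution in \<open>X\<close> and \<open>Y\<close> followed by division by \<open>E^e\<close>
  (\<open>algorithm_step_coeff_transformation\<close>). It remains to study sequences of series in two
  variables under the four transformations.

  Let \<open>f\<close> be a nonzero series in two variables, \<open>(p, d)\<close> the leftmost vertex of its Newton
  polyhedron, and \<open>height f\<close> the difference between \<open>d\<close> and the exponent of the highest power of \<open>Y\<close>
  dividing \<open>f\<close>; the polyhedron is a quadrant if the height is \<open>0\<close>. No transformation increases the
  height, and the quadratic transformation \<open>X \<mapsto> X Y\<close> decreases it unless it is \<open>0\<close>. So if that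
  transformation occurs infinitely often, the polyhedron is a quadrant from some step on.

  Otherwise only the other three transformations occur from some step on. They do not increase
  \<open>d\<close>, and \<open>Z \<mapsto> Y Z\<close> decreases it; hence later on \<open>d\<close> is constant and only
  \<open>Y \<mapsto> X (Y + b)\<close> and \<open>Z \<mapsto> X Z\<close> occur, the former infinitely often since the latter decreases \<open>p\<close>.
  The translations \<open>b\<close> used from step \<open>t\<close> on are the coefficients of a series \<open>h_t\<close> in \<open>K[[X]]\<close>
  with \<open>h_t = X (b_t + h_(t+1))\<close>, geometrically the curve \<open>Y = h_t(X)\<close> through the infinitely near
  centres of the quadratic transformations.
  After the transvection \<open>Y \<mapsto> Y + h_t\<close> the transformations become monomial: they send a
  monomial \<open>X^i Y^j\<close> to \<open>X^(i+j-e) Y^j\<close> or to \<open>X^(i-e) Y^j\<close>. Since \<open>d\<close> is constant, the vertex is transformed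
  in the same way, and a monomial with \<open>j < d\<close> would approach the line of abscissa \<open>p\<close>
  by \<open>d - j > 0\<close> in each of infinitely many steps, without ever crossing it. So there is none, and the
  transvection yields a quadrant (\<open>generalized_quadrant_constant_left_y\<close>).
\<close>

section \<open>Order filtration of \<open>K[[X,Y]]\<close>\<close>

definition order_ge :: "nat \<Rightarrow> 'a::zero ps2 \<Rightarrow> bool" where
  "order_ge N f \<longleftrightarrow> (\<forall>i j. i + j < N \<longrightarrow> coeff2 f i j = 0)"

definition cong_order :: "nat \<Rightarrow> 'a::ab_group_add ps2 \<Rightarrow> 'a ps2 \<Rightarrow> bool" where
  "cong_order N f g \<longleftrightarrow> (\<forall>i j. i + j < N \<longrightarrow> coeff2 f i j = coeff2 g i j)"

abbreviation const2 :: "'a::zero \<Rightarrow> 'a ps2" where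
  "const2 c \<equiv> fps_const (fps_const c)"

abbreviation X2 :: "'a::{zero,one} ps2" where
  "X2 \<equiv> fps_const fps_X"

abbreviation Y2 :: "'a::{zero,one} ps2" where
  "Y2 \<equiv> fps_X"

lemma ps2_eqI: "(\<And>i j. coeff2 f i j = coeff2 g i j) \<Longrightarrow> f = g"
  by (simp add: coeff2_def fps_eq_iff)

lemma coeff2_0 [simp]: "coeff2 0 i j = 0"
  by (simp add: coeff2_def)

lemma coeff2_add: "coeff2 (f + g) i j = coeff2 f i j + coeff2 g i j"
  by (simp add: coeff2_def)

lemma coeff2_sum: "coeff2 (sum f S) i j = (\<Sum>s\<in>S. coeff2 (f s) i j)"
  by (simp add: coeff2_def fps_sum_nth)

lemma coeff2_const2_mult [simp]: "coeff2 (const2 c * f) i j = c * coeff2 f i j"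
  for f :: "'a::comm_ring_1 ps2"
  by (simp add: coeff2_def)

lemma coeff2_mult:
  "coeff2 (f * g) p q = (\<Sum>j\<le>q. \<Sum>i\<le>p. coeff2 f i j * coeff2 g (p - i) (q - j))"
  for f :: "'a::comm_ring_1 ps2"
  by (simp add: coeff2_def fps_mult_nth fps_sum_nth atMost_atLeast0)

lemma coeff2_X2_power_mult:
  "coeff2 (X2 ^ m * f) i j = (if i < m then 0 else coeff2 f (i - m) j)"
  for f :: "'a::comm_ring_1 ps2"
  by (simp add: coeff2_def fps_const_power fps_X_power_mult_nth)

lemma coeff2_Y2_power_mult:
  "coeff2 (Y2 ^ m * f) i j = (if j < m then 0 else coeff2 f i (j - m))"
  for f :: "'a::comm_ring_1 ps2"
  by (simp add: coeff2_def fps_X_power_mult_nth)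

lemma order_ge_mult:
  fixes f g :: "'a::comm_ring_1 ps2"
  assumes "order_ge a f" "order_ge b g"
  shows "order_ge (a + b) (f * g)"
proof -
  have "coeff2 f i j * coeff2 g (p - i) (q - j) = 0"
    if "p + q < a + b" "j \<le> q" "i \<le> p" for p q i j
  proof -
    have "i + j < a \<or> (p - i) + (q - j) < b" using that by linarith
    then show ?thesis using assms unfolding order_ge_def by (auto simp: Let_def)
  qed
  then show ?thesis by (simp add: order_ge_def coeff2_mult)
qed

lemma order_ge_power:
  fixes f :: "'a::comm_ring_1 ps2"
  assumes "order_ge 1 f"
  shows "order_ge k (f ^ k)"
proof (induction k)
  case 0
  then show ?case by (simp add: order_ge_def)
next
  case (Suc k)
  then show ?case using order_ge_mult[OF assms Suc] by simp
qed

lemma order_ge_power_mult_power: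
  fixes f g :: "'a::comm_ring_1 ps2"
  assumes "order_ge 1 f" "order_ge 1 g"
  shows "order_ge (i + j) (f ^ i * g ^ j)"
  using assms by (intro order_ge_mult order_ge_power)

lemma order_ge_coeff: "order_ge N f \<Longrightarrow> i + j < N \<Longrightarrow> coeff2 f i j = 0"
  by (simp add: order_ge_def)

lemma cong_orderD: "cong_order N f g \<Longrightarrow> i + j < N \<Longrightarrow> coeff2 f i j = coeff2 g i j"
  by (simp add: cong_order_def)

lemma cong_order_sym: "cong_order N f g \<Longrightarrow> cong_order N g f"
  by (simp add: cong_order_def)

lemma cong_order_trans [trans]: "cong_order N f g \<Longrightarrow> cong_order N g h \<Longrightarrow> cong_order N f h"
  by (simp add: cong_order_def)

lemma cong_order_eqI: "(\<And>N. cong_order N f g) \<Longrightarrow> f = g"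
  by (rule ps2_eqI) (metis cong_order_def lessI)

lemma cong_order_mult:
  fixes f g h :: "'a::comm_ring_1 ps2"
  assumes "cong_order N f g"
  shows "cong_order N (f * h) (g * h)"
  using assms by (auto simp: cong_order_def coeff2_mult intro!: sum.cong)

lemma fps_X_plus_const_power_nth:
  "fps_nth ((fps_X + fps_const c) ^ k) r = of_nat (k choose r) * c ^ (k - r)"
  for c :: "'a::comm_ring_1"
proof -
  have "(fps_X + fps_const c) ^ k
      = (\<Sum>l\<le>k. fps_const (of_nat (k choose l) * c ^ (k - l)) * fps_X ^ l)"
    by (simp add: binomial_ring fps_const_power fps_of_nat [symmetric] algebra_simps
        flip: fps_const_mult)
  then have "fps_nth ((fps_X + fps_const c) ^ k) r
      = (\<Sum>l\<le>k. if r = l then of_nat (k choose l) * c ^ (k - l) else 0)"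
    by (simp add: fps_sum_nth fps_X_power_nth if_distrib cong: if_cong)
  then show ?thesis by (cases "r \<le> k") (simp_all add: sum.delta binomial_eq_0)
qed


section \<open>Substitution\<close>

definition Abs_ps2 :: "(nat \<Rightarrow> nat \<Rightarrow> 'a::zero) \<Rightarrow> 'a ps2" where
  "Abs_ps2 f = Abs_fps (\<lambda>j. Abs_fps (\<lambda>i. f i j))"

lemma coeff2_Abs_ps2 [simp]: "coeff2 (Abs_ps2 f) i j = f i j"
  by (simp add: Abs_ps2_def coeff2_def)

text \<open>
  As for \<open>subst3\<close>, this is the image of \<open>f\<close> under \<open>X \<mapsto> A\<close>, \<open>Y \<mapsto> B\<close> if \<open>A\<close> and \<open>B\<close> have no
  constant term: then the finite sum contains all contributions to the coefficient.
\<close>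

definition subst2 :: "'a::comm_ring_1 ps2 \<Rightarrow> 'a ps2 \<Rightarrow> 'a ps2 \<Rightarrow> 'a ps2" where
  "subst2 f A B = Abs_ps2 (\<lambda>p q. \<Sum>(i, j) \<in> {(i, j). i + j \<le> p + q}.
     coeff2 f i j * coeff2 (A ^ i * B ^ j) p q)"

lemma finite_pairs [simp]:
  "finite {(i, j). i + j \<le> (N::nat)}" "finite {(i, j). i + j < (N::nat)}"
  by (rule finite_subset[of _ "{..N} \<times> {..N}"]; auto)+

lemma finite_triples [simp]: "finite {(i, j, k). i + j + k \<le> (N::nat)}"
  by (rule finite_subset[of _ "{..N} \<times> {..N} \<times> {..N}"]) auto

text \<open>
  Up to any given order, a substitution is evaluation of a polynomial; this is how
  identities between substitutions are reduced to finite sums.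
\<close>

lemma subst2_cong_order:
  fixes f :: "'a::comm_ring_1 ps2"
  assumes "order_ge 1 A" "order_ge 1 B"
  shows "cong_order N (subst2 f A B)
    (\<Sum>(i, j) \<in> {(i, j). i + j < N}. const2 (coeff2 f i j) * (A ^ i * B ^ j))"
proof -
  have zero: "coeff2 (A ^ i * B ^ j) p q = 0" if "p + q < i + j" for i j p q
    using order_ge_power_mult_power[OF assms, of i j] that by (rule order_ge_coeff)
  have "(\<Sum>(i, j) \<in> {(i, j). i + j \<le> p + q}. coeff2 f i j * coeff2 (A ^ i * B ^ j) p q)
      = (\<Sum>(i, j) \<in> {(i, j). i + j < N}. coeff2 f i j * coeff2 (A ^ i * B ^ j) p q)"
    if "p + q < N" for p q
    using that by (intro sum.mono_neutral_left) (auto, metis zero mult_zero_right not_le)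
  then show ?thesis
    by (simp add: cong_order_def subst2_def coeff2_sum case_prod_beta)
qed

text \<open>
  The substitutions of the algorithm send \<open>Z\<close> to \<open>E (Z + c)\<close>, and \<open>X\<close>, \<open>Y\<close> to series free of \<open>Z\<close>. Hence
  they act on each coefficient of \<open>Z^k\<close> by \<open>subst2\<close>, and the powers of \<open>Z + c\<close> are expanded
  by the binomial theorem.
\<close>

lemma coeff_Z_subst3_proportional:
  fixes F :: "'a::comm_ring_1 ps3"
  assumes "order_ge 1 A" "order_ge 1 B" "order_ge 1 E"
    and deg: "\<And>k. k > n \<Longrightarrow> fps_nth F k = 0"
  shows "fps_nth (subst3 F (fps_const A) (fps_const B) (fps_const E * (varZ + const3 c))) r
    = (\<Sum>k\<le>n. const2 (of_nat (k choose r) * c ^ (k - r)) * (subst2 (fps_nth F k) A B * E ^ k))"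
    (is "?L = ?R")
proof (rule ps2_eqI)
  fix p q
  define N where "N = Suc (p + q + r)"
  define w where "w k = of_nat (k choose r) * c ^ (k - r)" for k
  define t where "t i j k = coeff3 F i j k * (w k * coeff2 (A ^ i * B ^ j * E ^ k) p q)" for i j k
  have C: "fps_nth (fps_const A ^ i * fps_const B ^ j * (fps_const E * (varZ + const3 c)) ^ k) r
      = const2 (w k) * (A ^ i * B ^ j * E ^ k)" for i j k
  proof -
    have "fps_const A ^ i * fps_const B ^ j * (fps_const E * (varZ + const3 c)) ^ k
        = fps_const (A ^ i * B ^ j * E ^ k) * (varZ + const3 c) ^ k"
      by (simp only: power_mult_distrib fps_const_power fps_const_mult [symmetric] mult.assoc)
    moreover have "of_nat (k choose r) * const2 c ^ (k - r) = const2 (w k)"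
      by (simp add: w_def fps_const_power flip: fps_const_mult fps_of_nat)
    ultimately show ?thesis
      by (simp only: fps_mult_left_const_nth fps_X_plus_const_power_nth) (simp only: mult.commute)
  qed
  have zero: "coeff2 (A ^ i * B ^ j * E ^ k) p q = 0" if "p + q < i + j + k" for i j k
    using order_ge_mult[OF order_ge_power_mult_power[OF assms(1,2)] order_ge_power[OF assms(3)],
        of i j k] that
    by (rule order_ge_coeff)
  (* A bounded set of triples and a product set replace each other, since terms outside
     their intersection vanish for reasons of order or of degree in Z. *)
  have t_zero: "t i j k = 0" if "n < k \<or> p + q < i + j + k" for i j k
    using that by (auto simp: t_def zero coeff3_def deg)
  have "coeff2 ?L p q = coeff3 (subst3 F (fps_const A) (fps_const B) (fps_const E * (varZ + const3 c))) p q r"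
    by (simp add: coeff3_def)
  also have "\<dots> = (\<Sum>(i, j, k) \<in> {(i, j, k). i + j + k \<le> p + q + r}. t i j k)"
  proof -
    have "coeff3 (fps_const A ^ i * fps_const B ^ j * (fps_const E * (varZ + const3 c)) ^ k) p q r
        = w k * coeff2 (A ^ i * B ^ j * E ^ k) p q" for i j k
      by (simp only: coeff3_def C coeff2_const2_mult)
    then show ?thesis by (simp only: subst3_def coeff3_Abs_ps3 t_def)
  qed
  also have "\<dots> = (\<Sum>((i, j), k) \<in> {((i, j), k). i + j + k \<le> p + q + r}. t i j k)"
    by (rule sum.reindex_bij_witness[of _ "\<lambda>((i, j), k). (i, j, k)" "\<lambda>(i, j, k). ((i, j), k)"]) auto
  also have "\<dots> = (\<Sum>((i, j), k) \<in> {(i, j). i + j < N} \<times> {..n}. t i j k)"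
  proof (rule sum.mono_neutral_cong)
    show "finite {((i, j), k). i + j + k \<le> p + q + r}"
      by (rule finite_subset[of _ "({..p+q+r} \<times> {..p+q+r}) \<times> {..p+q+r}"]) auto
  qed (auto simp: N_def, (rule ccontr, simp add: t_zero)+)
  also have "\<dots> = (\<Sum>ij \<in> {(i, j). i + j < N}. \<Sum>k\<le>n. t (fst ij) (snd ij) k)"
    by (simp add: sum.cartesian_product case_prod_beta)
  also have "\<dots> = (\<Sum>k\<le>n. \<Sum>ij \<in> {(i, j). i + j < N}. t (fst ij) (snd ij) k)"
    by (rule sum.swap)
  also have "\<dots> = (\<Sum>k\<le>n. w k * coeff2 (subst2 (fps_nth F k) A B * E ^ k) p q)"
  proof (rule sum.cong)
    fix k
    have "coeff2 (subst2 (fps_nth F k) A B * E ^ k) p q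
      = coeff2 ((\<Sum>(i, j) \<in> {(i, j). i + j < N}.
          const2 (coeff2 (fps_nth F k) i j) * (A ^ i * B ^ j)) * E ^ k) p q"
      by (rule cong_orderD[OF cong_order_mult[OF subst2_cong_order[OF assms(1,2)]]])
        (simp add: N_def)
    also have "\<dots> = (\<Sum>ij \<in> {(i, j). i + j < N}.
        coeff2 (const2 (coeff2 (fps_nth F k) (fst ij) (snd ij))
          * (A ^ fst ij * B ^ snd ij * E ^ k)) p q)"
      by (simp only: sum_distrib_right coeff2_sum case_prod_beta mult.assoc)
    finally have *: "coeff2 (subst2 (fps_nth F k) A B * E ^ k) p q = \<dots>" .
    show "(\<Sum>ij \<in> {(i, j). i + j < N}. t (fst ij) (snd ij) k)
        = w k * coeff2 (subst2 (fps_nth F k) A B * E ^ k) p q"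
      unfolding * t_def coeff2_const2_mult sum_distrib_left coeff3_def
      by (simp only: mult.left_commute)
  qed simp
  also have "\<dots> = coeff2 ?R p q"
    by (simp add: coeff2_sum w_def del: fps_const_mult)
  finally show "coeff2 ?L p q = coeff2 ?R p q" .
qed

lemma coeff_Z_transvection:
  fixes F :: "'a::comm_ring_1 ps3"
  shows "fps_nth (transvection h F) r = subst2 (fps_nth F r) X2 (Y2 + fps_const h)"
    (is "_ = subst2 _ _ ?B")
proof (rule ps2_eqI)
  fix p q
  have C: "fps_nth (varX ^ i * (varY + fps_const (fps_const h)) ^ j * varZ ^ k) r
      = (if k = r then X2 ^ i * ?B ^ j else 0)" for i j k
  proof -
    have "varX ^ i * (varY + fps_const (fps_const h)) ^ j * varZ ^ k
        = fps_const (X2 ^ i * ?B ^ j) * varZ ^ k"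
    proof -
      have "varY + fps_const (fps_const h) = fps_const ?B" by (simp only: fps_const_add)
      then show ?thesis by (simp only: fps_const_power fps_const_mult)
    qed
    then show ?thesis
      by (simp only: fps_mult_left_const_nth fps_X_power_nth) auto
  qed
  have "coeff2 (fps_nth (transvection h F) r) p q
      = (\<Sum>(i, j, k) \<in> {(i, j, k). i + j + k \<le> p + q + r}.
          coeff3 F i j k * (if k = r then coeff2 (X2 ^ i * ?B ^ j) p q else 0))"
    unfolding coeff3_def[symmetric]
    by (auto simp add: transvection_def subst3_def coeff3_def[of "_ * _"] C intro!: sum.cong)
  also have "\<dots> = (\<Sum>(i, j, k) \<in> {(i, j, k). i + j \<le> p + q \<and> k = r}.
      coeff3 F i j k * coeff2 (X2 ^ i * ?B ^ j) p q)"
    by (intro sum.mono_neutral_cong_right) (auto split: if_splits)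
  also have "\<dots> = (\<Sum>(i, j) \<in> {(i, j). i + j \<le> p + q}.
      coeff2 (fps_nth F r) i j * coeff2 (X2 ^ i * ?B ^ j) p q)"
    by (rule sum.reindex_bij_witness[of _ "\<lambda>(i, j). (i, j, r)" "\<lambda>(i, j, k). (i, j)"])
      (auto simp: coeff3_def)
  finally show "coeff2 (fps_nth (transvection h F) r) p q = coeff2 (subst2 (fps_nth F r) X2 ?B) p q"
    by (simp add: subst2_def)
qed


lemma subst2_cong:
  "cong_order N f g \<Longrightarrow> cong_order N (subst2 f A B) (subst2 g A B)"
  unfolding cong_order_def subst2_def by (auto intro!: sum.cong)

lemma subst2_add: "subst2 (f + g) A B = subst2 f A B + subst2 g A B"
  by (rule ps2_eqI)
    (simp add: subst2_def coeff2_add case_prod_beta distrib_right sum.distrib)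

lemma subst2_0 [simp]: "subst2 0 A B = 0"
  by (rule ps2_eqI) (simp add: subst2_def)

lemma subst2_sum: "subst2 (sum f S) A B = (\<Sum>s\<in>S. subst2 (f s) A B)"
  by (induction S rule: infinite_finite_induct) (simp_all add: subst2_add)

lemma order_ge_X2 [simp]: "order_ge (Suc 0) X2"
  by (simp add: order_ge_def coeff2_def)

lemma order_ge_Y2 [simp]: "order_ge (Suc 0) Y2"
  by (simp add: order_ge_def coeff2_def)

text \<open>
  For a substitution that fixes \<open>X\<close>, the coefficients can be taken in \<open>K[[X]]\<close>. It is linear over
  that ring, which makes composition with another such substitution easy to compute.
\<close>

lemma subst2_X_cong_order:
  fixes f :: "'a::comm_ring_1 ps2"
  assumes "order_ge 1 B"
  shows "cong_order N (subst2 f X2 B) (\<Sum>j<N. fps_const (fps_nth f j) * B ^ j)"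
  unfolding cong_order_def
proof (intro allI impI)
  fix p q assume pq: "p + q < N"
  define t where "t i j = coeff2 f i j * coeff2 (X2 ^ i * B ^ j) p q" for i j
  have X: "order_ge 1 X2" by simp
  have "t i j = 0" if "p + q < i + j" for i j
    unfolding t_def
    by (simp only: order_ge_coeff[OF order_ge_power_mult_power[OF X assms] that] mult_zero_right)
  moreover have "t i j = 0" if "p < i" for i j
    using that unfolding t_def coeff2_X2_power_mult by simp
  ultimately have zero: "t i j = 0" if "p + q < i + j \<or> p < i" for i j
    using that by blast
  have "coeff2 (fps_const (fps_nth f j) * B ^ j) p q = (\<Sum>i\<le>p. t i j)" for j
    unfolding t_def coeff2_X2_power_mult
    by (simp add: coeff2_def) (simp add: fps_mult_nth atMost_atLeast0)
  then have "coeff2 (\<Sum>j<N. fps_const (fps_nth f j) * B ^ j) p q = (\<Sum>j<N. \<Sum>i\<le>p. t i j)"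
    by (simp add: coeff2_sum)
  also have "\<dots> = (\<Sum>i\<le>p. \<Sum>j<N. t i j)" by (rule sum.swap)
  also have "\<dots> = (\<Sum>(i, j) \<in> {..p} \<times> {..<N}. t i j)"
    by (simp add: sum.cartesian_product)
  also have "\<dots> = (\<Sum>(i, j) \<in> {(i, j). i + j \<le> p + q}. t i j)"
    using pq by (intro sum.mono_neutral_cong) (auto, (rule ccontr, simp add: zero)+)
  also have "\<dots> = coeff2 (subst2 f X2 B) p q"
    by (simp add: subst2_def t_def)
  finally show "coeff2 (subst2 f X2 B) p q
      = coeff2 (\<Sum>j<N. fps_const (fps_nth f j) * B ^ j) p q" by simp
qed

lemma subst2_X_const_mult:
  fixes f :: "'a::comm_ring_1 ps2"
  assumes "order_ge 1 B"
  shows "subst2 (fps_const c * f) X2 B = fps_const c * subst2 f X2 B"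
proof (rule cong_order_eqI)
  fix N
  have "cong_order N (subst2 f X2 B * fps_const c)
      ((\<Sum>j<N. fps_const (fps_nth f j) * B ^ j) * fps_const c)"
    by (intro cong_order_mult subst2_X_cong_order assms)
  also have "(\<Sum>j<N. fps_const (fps_nth f j) * B ^ j) * fps_const c
      = (\<Sum>j<N. fps_const (fps_nth (fps_const c * f) j) * B ^ j)"
    unfolding sum_distrib_right fps_mult_left_const_nth fps_const_mult [symmetric]
    by (simp only: mult_ac)
  finally show "cong_order N (subst2 (fps_const c * f) X2 B) (fps_const c * subst2 f X2 B)"
    using subst2_X_cong_order[OF assms, of N "fps_const c * f"]
    by (simp add: cong_order_def mult.commute)
qed

lemma subst2_X_Y_power:
  fixes B :: "'a::comm_ring_1 ps2"
  assumes "order_ge 1 B"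
  shows "subst2 (Y2 ^ l) X2 B = B ^ l"
proof (rule cong_order_eqI)
  fix N
  have "fps_const (fps_nth (Y2 ^ l) j) * B ^ j = (if j = l then B ^ l else 0)" for j
    by auto
  then have "(\<Sum>j<N. fps_const (fps_nth (Y2 ^ l) j) * B ^ j) = (if l < N then B ^ l else 0)"
    by simp
  moreover have "cong_order N (if l < N then B ^ l else 0) (B ^ l)"
    using order_ge_power[OF assms, of l] by (auto simp: cong_order_def order_ge_def)
  ultimately show "cong_order N (subst2 (Y2 ^ l) X2 B) (B ^ l)"
    using subst2_X_cong_order[OF assms, of N "Y2 ^ l"] by (simp add: cong_order_def)
qed

lemma subst2_X_linear_power:
  fixes C :: "'a::comm_ring_1 ps2"
  assumes "order_ge 1 C"
  shows "subst2 ((fps_const u + fps_const v * Y2) ^ j) X2 C = (fps_const u + fps_const v * C) ^ j"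
proof -
  have expand: "(fps_const u + fps_const v * D) ^ j
      = (\<Sum>l\<le>j. fps_const (of_nat (j choose l) * u ^ l * v ^ (j - l)) * D ^ (j - l))"
    for D :: "'a ps2"
    by (simp only: binomial_ring power_mult_distrib fps_const_power fps_const_mult [symmetric]
        fps_of_nat mult.assoc)
  show ?thesis
    unfolding expand
    by (simp only: subst2_sum subst2_X_const_mult[OF assms] subst2_X_Y_power[OF assms])
qed

text \<open>
  Only a first substitution \<open>Y \<mapsto> u + v Y\<close> of degree \<open>1\<close> in \<open>Y\<close> is needed. Then the powers of the image of
  \<open>Y\<close> are polynomials in \<open>Y\<close>, so that multiplicativity of substitution for arbitrary power series
  can be avoided.
\<close>

lemma subst2_X_compose:
  fixes f :: "'a::comm_ring_1 ps2"
  assumes u: "fps_nth u 0 = 0" and C: "order_ge 1 C"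
  shows "subst2 (subst2 f X2 (fps_const u + fps_const v * Y2)) X2 C
    = subst2 f X2 (fps_const u + fps_const v * C)"
    (is "subst2 (subst2 f X2 ?B) X2 C = subst2 f X2 ?D")
proof (rule cong_order_eqI)
  fix N
  have B: "order_ge 1 ?B" using u by (simp add: order_ge_def coeff2_def)
  have D: "order_ge 1 ?D" using u C by (simp add: order_ge_def coeff2_def fps_mult_nth)
  have "cong_order N (subst2 (subst2 f X2 ?B) X2 C)
      (subst2 (\<Sum>j<N. fps_const (fps_nth f j) * ?B ^ j) X2 C)"
    by (intro subst2_cong subst2_X_cong_order B)
  also have "subst2 (\<Sum>j<N. fps_const (fps_nth f j) * ?B ^ j) X2 C
      = (\<Sum>j<N. fps_const (fps_nth f j) * ?D ^ j)"
    by (simp only: subst2_sum subst2_X_const_mult[OF C] subst2_X_linear_power[OF C])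
  also have "cong_order N \<dots> (subst2 f X2 ?D)"
    by (rule cong_order_sym[OF subst2_X_cong_order[OF D]])
  finally show "cong_order N (subst2 (subst2 f X2 ?B) X2 C) (subst2 f X2 ?D)" .
qed

lemma subst2_X_Y: "subst2 f X2 Y2 = f" for f :: "'a::comm_ring_1 ps2"
proof (rule cong_order_eqI)
  fix N
  have "coeff2 (fps_const (fps_nth f j) * Y2 ^ j) p q = (if j = q then coeff2 f p j else 0)"
    for j p q
    by (auto simp: coeff2_def fps_X_power_nth)
  then have "cong_order N (\<Sum>j<N. fps_const (fps_nth f j) * Y2 ^ j) f"
    by (simp add: cong_order_def coeff2_sum)
  then show "cong_order N (subst2 f X2 Y2) f"
    using subst2_X_cong_order[of Y2 N f] by (simp add: cong_order_def)
qed

lemma coeff2_subst2_quadratic_X: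
  fixes f :: "'a::comm_ring_1 ps2"
  shows "coeff2 (subst2 f X2 (X2 * (Y2 + const2 b))) p q
    = (\<Sum>j\<le>p. coeff2 f (p - j) j * (of_nat (j choose q) * b ^ (j - q)))"
proof -
  let ?B = "X2 * (Y2 + const2 b)"
  have B: "order_ge 1 ?B"
    by (simp add: order_ge_def coeff2_def)
  have "coeff2 (fps_const (fps_nth f j) * ?B ^ j) p q
      = (if p < j then 0 else coeff2 f (p - j) j * (of_nat (j choose q) * b ^ (j - q)))" for j
  proof -
    have "fps_const (fps_nth f j) * ?B ^ j
        = X2 ^ j * (fps_const (fps_nth f j) * (Y2 + const2 b) ^ j)"
      by (simp only: power_mult_distrib mult_ac)
    then have "coeff2 (fps_const (fps_nth f j) * ?B ^ j) p q
      = (if p < j then 0 else coeff2 (fps_const (fps_nth f j) * (Y2 + const2 b) ^ j) (p - j) q)"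
      by (simp only: coeff2_X2_power_mult)
    moreover have "fps_nth ((Y2 + const2 b) ^ j) q = fps_const (of_nat (j choose q) * b ^ (j - q))"
      by (simp only: fps_X_plus_const_power_nth fps_const_power fps_of_nat [symmetric] fps_const_mult)
    ultimately show ?thesis by (simp add: coeff2_def)
  qed
  then have "coeff2 (subst2 f X2 ?B) p q = (\<Sum>j<Suc (p + q).
      (if p < j then 0 else coeff2 f (p - j) j * (of_nat (j choose q) * b ^ (j - q))))"
    using cong_orderD[OF subst2_X_cong_order[OF B], of p q "Suc (p + q)" f]
    by (simp only: coeff2_sum)
  also have "\<dots> = (\<Sum>j\<le>p. coeff2 f (p - j) j * (of_nat (j choose q) * b ^ (j - q)))"
    by (intro sum.mono_neutral_cong_right) auto
  finally show ?thesis .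
qed

lemma coeff2_subst2_quadratic_Y:
  fixes f :: "'a::comm_ring_1 ps2"
  shows "coeff2 (subst2 f (X2 * Y2) Y2) p q = (if p \<le> q then coeff2 f p (q - p) else 0)"
proof -
  have C: "coeff2 ((X2 * Y2) ^ i * Y2 ^ j :: 'a ps2) p q = (if i = p \<and> i + j = q then 1 else 0)" for i j
  proof -
    have *: "(X2 * Y2) ^ i * Y2 ^ j = X2 ^ i * (Y2 ^ (i + j) * (1 :: 'a ps2))"
      by (simp only: power_mult_distrib mult_ac power_add mult_1_left mult_1_right)
    show ?thesis
      unfolding * coeff2_X2_power_mult coeff2_Y2_power_mult by (auto simp: coeff2_def)
  qed
  have "coeff2 (subst2 f (X2 * Y2) Y2) p q = (\<Sum>(i, j) \<in> {(i, j). i + j \<le> p + q}.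
      coeff2 f i j * (if i = p \<and> i + j = q then 1 else 0))"
    by (simp only: subst2_def coeff2_Abs_ps2 C)
  also have "\<dots> = (\<Sum>(i, j) \<in> (if p \<le> q then {(p, q - p)} else {}). coeff2 f i j)"
    by (intro sum.mono_neutral_cong_right) (auto split: if_splits)
  finally show ?thesis by simp
qed


section \<open>Transformation of the coefficients of a WT equation\<close>

text \<open>
  The effect of a step of the algorithm on the coefficient \<open>f\<close> of \<open>Z^k\<close>, with \<open>e = n - k\<close>: the factor
  \<open>E^n\<close> removed from the equation is reduced by the factor \<open>E^k\<close> that \<open>Z^k\<close> contributes.
\<close>

inductive coeff_transformation :: "nat \<Rightarrow> 'a::comm_ring_1 ps2 \<Rightarrow> 'a ps2 \<Rightarrow> bool"
  for e f f' where
  quadratic_X: "subst2 f X2 (X2 * (Y2 + const2 b)) = X2 ^ e * f' \<Longrightarrow> coeff_transformation e f f'"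
| quadratic_Y: "subst2 f (X2 * Y2) Y2 = Y2 ^ e * f' \<Longrightarrow> coeff_transformation e f f'"
| monoidal_ZX: "f = X2 ^ e * f' \<Longrightarrow> coeff_transformation e f f'"
| monoidal_ZY: "f = Y2 ^ e * f' \<Longrightarrow> coeff_transformation e f f'"

lemma ord2_ge_iff: "enat N \<le> ord2 f \<longleftrightarrow> order_ge N f"
proof -
  have "enat N \<le> ord2 f \<longleftrightarrow> (\<forall>i j. coeff2 f i j \<noteq> 0 \<longrightarrow> N \<le> i + j)"
    unfolding ord2_def le_Inf_iff by (auto; metis enat_ord_simps(1))
  then show ?thesis unfolding order_ge_def by (meson not_le)
qed

lemma coeff3_below_ord3:
  assumes "ord3 F = enat n" "i + j + k < n"
  shows "coeff3 F i j k = 0"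
proof (rule ccontr)
  assume "coeff3 F i j k \<noteq> 0"
  then have "ord3 F \<le> enat (i + j + k)"
    unfolding ord3_def by (intro Inf_lower) auto
  with assms show False by simp
qed

lemma WT_equation_iff:
  fixes F :: "'a::comm_ring_1 ps3"
  assumes "n \<ge> 2"
  shows "WT_equation n F \<longleftrightarrow> fps_nth F n = 1 \<and> fps_nth F (n - 1) = 0 \<and>
    (\<forall>k>n. fps_nth F k = 0) \<and> (\<forall>k\<le>n - 2. order_ge (n - k) (fps_nth F k))"
    (is "_ \<longleftrightarrow> ?R")
proof -
  have nth: "fps_nth (varZ ^ n + (\<Sum>k\<le>n - 2. fps_const (a k) * varZ ^ k)) r
      = (if r = n then 1 else if r \<le> n - 2 then a r else 0)" for a :: "nat \<Rightarrow> 'a ps2" and r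
  proof -
    have "fps_nth (fps_const (a k) * varZ ^ k) r = (if k = r then a k else 0)" for k
      by (auto simp: fps_X_power_nth)
    then show ?thesis using assms by (auto simp: fps_sum_nth fps_X_power_nth)
  qed
  show ?thesis
  proof
    assume "WT_equation n F"
    then obtain a where F: "F = varZ ^ n + (\<Sum>k\<le>n - 2. fps_const (a k) * varZ ^ k)"
      and a: "\<forall>k\<le>n - 2. order_ge (n - k) (a k)"
      by (auto simp: WT_equation_def ord2_ge_iff)
    show ?R unfolding F nth using assms a by auto
  next
    assume R: ?R
    have "F = varZ ^ n + (\<Sum>k\<le>n - 2. fps_const (fps_nth F k) * varZ ^ k)"
    proof (rule fps_ext)
      fix r
      have "r = n - 1" if "\<not> r > n" "r \<noteq> n" "\<not> r \<le> n - 2" using that assms by linarith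
      then show "fps_nth F r
          = fps_nth (varZ ^ n + (\<Sum>k\<le>n - 2. fps_const (fps_nth F k) * varZ ^ k)) r"
        unfolding nth using R by metis
    qed
    with R show "WT_equation n F"
      by (auto simp: WT_equation_def ord2_ge_iff)
  qed
qed

lemma subst2_1: "subst2 1 A B = 1"
proof (rule ps2_eqI)
  fix p q
  have "coeff2 (subst2 1 A B) p q = (\<Sum>(i, j) \<in> {(0, 0)}. coeff2 (A ^ i * B ^ j) p q)"
    unfolding subst2_def coeff2_Abs_ps2
    by (intro sum.mono_neutral_cong_right) (auto simp: coeff2_def split: if_splits)
  then show "coeff2 (subst2 1 A B) p q = coeff2 1 p q" by simp
qed

text \<open>
  The coefficient of \<open>Z^(n-1)\<close> of \<open>G\<close> is \<open>n c\<close>, because \<open>F\<close> has no term in \<open>Z^(n-1)\<close>. It has no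
  constant term, since \<open>G\<close> has order \<open>n\<close>; therefore \<open>c = 0\<close>, and comparing the coefficients of \<open>Z^k\<close>
  no longer mixes different powers of \<open>Z\<close>.
\<close>

lemma WT_substitution:
  fixes F G :: "'a::field_char_0 ps3"
  assumes n: "n \<ge> 2" and "order_ge 1 A" "order_ge 1 B" "order_ge 1 E" "E \<noteq> 0"
    and F: "WT_equation n F" and G: "ord3 G = enat n"
    and eq: "subst3 F (fps_const A) (fps_const B) (fps_const E * (varZ + const3 c))
      = fps_const E ^ n * G"
  shows "WT_equation n G \<and> (\<forall>k\<le>n. subst2 (fps_nth F k) A B = E ^ (n - k) * fps_nth G k)"
proof -
  have F_n: "fps_nth F n = 1" and F_n1: "fps_nth F (n - 1) = 0"
    and F_gt: "\<And>k. k > n \<Longrightarrow> fps_nth F k = 0"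
    using F n by (auto simp: WT_equation_iff)
  define t where "t r k = const2 (of_nat (k choose r) * c ^ (k - r)) *
    (subst2 (fps_nth F k) A B * E ^ k)" for r k
  have coeff_eq: "E ^ n * fps_nth G r = (\<Sum>k\<le>n. t r k)" for r
    using coeff_Z_subst3_proportional[OF assms(2-4) F_gt, of n c r] unfolding eq t_def
    by (simp only: fps_const_power fps_mult_left_const_nth)
  have "(\<Sum>k\<le>n. t (n - 1) k) = (\<Sum>k\<in>{n}. t (n - 1) k)"
  proof (rule sum.mono_neutral_right)
    show "\<forall>k\<in>{..n} - {n}. t (n - 1) k = 0"
    proof
      fix k assume "k \<in> {..n} - {n}"
      then have "k < n - 1 \<or> k = n - 1" using n by auto
      then show "t (n - 1) k = 0" by (auto simp: t_def F_n1[simplified] binomial_eq_0)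
    qed
  qed auto
  also have "\<dots> = E ^ n * const2 (of_nat n * c)"
    using n binomial_symmetric[of 1 n] by (simp add: t_def F_n subst2_1 mult.commute del: fps_const_mult)
  finally have G_n1: "fps_nth G (n - 1) = const2 (of_nat n * c)"
    using coeff_eq[of "n - 1"] \<open>E \<noteq> 0\<close> by (simp del: fps_const_mult)
  have "coeff3 G 0 0 (n - 1) = 0"
    using n by (intro coeff3_below_ord3[OF G]) auto
  then have c: "c = 0"
    using n by (simp add: coeff3_def coeff2_def G_n1[simplified])
  have coeff_eq': "E ^ n * fps_nth G r = (if r \<le> n then subst2 (fps_nth F r) A B * E ^ r else 0)"
    for r
  proof -
    have "t r k = (if k = r then subst2 (fps_nth F k) A B * E ^ k else 0)" for k
      by (cases k r rule: linorder_cases) (simp_all add: t_def c binomial_eq_0)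
    then show ?thesis by (simp add: coeff_eq)
  qed
  have rel: "subst2 (fps_nth F k) A B = E ^ (n - k) * fps_nth G k" if "k \<le> n" for k
  proof -
    have "E ^ k * (E ^ (n - k) * fps_nth G k) = E ^ k * subst2 (fps_nth F k) A B"
      using coeff_eq'[of k] that by (simp add: mult_ac flip: power_add mult.assoc)
    then show ?thesis using \<open>E \<noteq> 0\<close> by simp
  qed
  have "order_ge (n - k) (fps_nth G k)" for k
    using coeff3_below_ord3[OF G] by (simp add: order_ge_def coeff3_def)
  moreover have "fps_nth G k = 0" if "k > n" for k
    using coeff_eq'[of k] that \<open>E \<noteq> 0\<close> by simp
  moreover have "fps_nth G n = 1" using rel[of n] by (simp add: F_n subst2_1)
  moreover have "fps_nth G (n - 1) = 0" using G_n1 c by simp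
  ultimately have "WT_equation n G"
    using n by (simp add: WT_equation_iff)
  with rel show ?thesis by blast
qed

lemma algorithm_step_coeff_transformation:
  fixes F G :: "'a::field_char_0 ps3"
  assumes n: "n \<ge> 2" and F: "WT_equation n F" and G: "ord3 G = enat n"
    and step: "algorithm_step n F G"
  shows "WT_equation n G \<and> (\<forall>k\<le>n. coeff_transformation (n - k) (fps_nth F k) (fps_nth G k))"
proof -
  note subst = WT_substitution[OF n _ _ _ _ F G]
  have XY: "order_ge 1 X2" "order_ge 1 Y2" "X2 \<noteq> (0 :: 'a ps2)" "Y2 \<noteq> (0 :: 'a ps2)"
    by simp_all
  have "order_ge 1 (X2 * (Y2 + const2 b) :: 'a ps2)" "order_ge 1 (X2 * Y2 :: 'a ps2)" for b
    by (simp_all add: order_ge_def coeff2_def)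
  note XY = XY this
  have C: "varX * (varY + const3 b) = fps_const (X2 * (Y2 + const2 b) :: 'a ps2)"
    "varX * varY = fps_const (X2 * Y2 :: 'a ps2)" for b
    by simp_all
  have quad: ?thesis if "quadratic_transformation n F G"
    using that
  proof cases
    case (quadratic_X a b c)
    from subst[OF XY(1,5,1,3) quadratic_X(3)[unfolded C]] show ?thesis
      by (blast intro: coeff_transformation.quadratic_X)
  next
    case (quadratic_Y b c)
    from subst[OF XY(6,2,2,4) quadratic_Y(3)[unfolded C]] show ?thesis
      by (blast intro: coeff_transformation.quadratic_Y)
  qed
  from step show ?thesis
  proof cases
    case monoidal_ZX
    then obtain a c where "subst3 F varX varY (varX * (varZ + const3 (c / a))) = varX ^ n * G"
      by (auto elim: monoidal_transformation_ZX.cases)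
    from subst[OF XY(1,2,1,3) this] show ?thesis
      unfolding subst2_X_Y by (blast intro: coeff_transformation.monoidal_ZX)
  next
    case monoidal_ZY
    then obtain b c where "subst3 F varX varY (varY * (varZ + const3 (c / b))) = varY ^ n * G"
      by (auto elim: monoidal_transformation_ZY.cases)
    from subst[OF XY(1,2,2,4) this] show ?thesis
      unfolding subst2_X_Y by (blast intro: coeff_transformation.monoidal_ZY)
  next
    case quadratic
    then show ?thesis using quad by blast
  qed
qed


section \<open>The left vertex and the height of a Newton polyhedron\<close>

definition left_vertex :: "'a::zero ps2 \<Rightarrow> nat \<Rightarrow> nat \<Rightarrow> bool" where
  "left_vertex f p d \<longleftrightarrow> coeff2 f p d \<noteq> 0 \<and>
     (\<forall>i j. coeff2 f i j \<noteq> 0 \<longrightarrow> p < i \<or> (p = i \<and> d \<le> j))"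

definition left_x :: "'a::zero ps2 \<Rightarrow> nat" where
  "left_x f = (LEAST i. \<exists>j. coeff2 f i j \<noteq> 0)"

definition left_y :: "'a::zero ps2 \<Rightarrow> nat" where
  "left_y f = (LEAST j. coeff2 f (left_x f) j \<noteq> 0)"

definition y_order :: "'a::zero ps2 \<Rightarrow> nat" where
  "y_order f = (LEAST j. \<exists>i. coeff2 f i j \<noteq> 0)"

definition height :: "'a::zero ps2 \<Rightarrow> nat" where
  "height f = left_y f - y_order f"

lemma ps2_nonzero_iff: "f \<noteq> 0 \<longleftrightarrow> (\<exists>i j. coeff2 f i j \<noteq> 0)"
  by (auto simp: coeff2_def fps_eq_iff)

lemma left_vertex_left_x_left_y:
  assumes "f \<noteq> 0"
  shows "left_vertex f (left_x f) (left_y f)"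
proof -
  have x: "\<exists>j. coeff2 f (left_x f) j \<noteq> 0"
    using assms unfolding left_x_def ps2_nonzero_iff by (rule LeastI_ex)
  then have "coeff2 f (left_x f) (left_y f) \<noteq> 0"
    unfolding left_y_def by (rule LeastI_ex)
  moreover have "left_x f \<le> i" if "coeff2 f i j \<noteq> 0" for i j
    unfolding left_x_def using that by (intro Least_le) blast
  moreover have "left_y f \<le> j" if "coeff2 f (left_x f) j \<noteq> 0" for j
    unfolding left_y_def using that by (rule Least_le)
  ultimately show ?thesis
    unfolding left_vertex_def using le_neq_implies_less by blast
qed

lemma left_vertex_unique:
  assumes "left_vertex f p d" "left_vertex f p' d'"
  shows "p = p' \<and> d = d'"
proof -
  have "p < p' \<or> (p = p' \<and> d \<le> d')" "p' < p \<or> (p' = p \<and> d' \<le> d)"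
    using assms unfolding left_vertex_def by blast+
  then show ?thesis by auto
qed

lemma left_vertex_le:
  assumes "left_vertex f p d" "coeff2 f i j \<noteq> 0"
  shows "p \<le> i"
proof -
  have "p < i \<or> p = i" using assms unfolding left_vertex_def by blast
  then show ?thesis by auto
qed

lemma left_vertex_nonzero: "left_vertex f p d \<Longrightarrow> f \<noteq> 0"
  by (auto simp: left_vertex_def)

lemma left_x_eq: "left_vertex f p d \<Longrightarrow> left_x f = p"
  and left_y_eq: "left_vertex f p d \<Longrightarrow> left_y f = d"
  using left_vertex_left_x_left_y left_vertex_nonzero left_vertex_unique by blast+

lemma y_order_le: "coeff2 f i j \<noteq> 0 \<Longrightarrow> y_order f \<le> j"
  unfolding y_order_def by (intro Least_le) blast

lemma y_order_attained: "f \<noteq> 0 \<Longrightarrow> \<exists>i. coeff2 f i (y_order f) \<noteq> 0"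
  unfolding y_order_def ps2_nonzero_iff by (rule LeastI_ex) blast

text \<open>
  An extreme point of the hull of a set lies in the set. Here it is an integral point in the
  quadrant with corner \<open>(p, q)\<close>, and unless it is the corner, it is the midpoint of its two
  horizontal or vertical neighbours.
\<close>

lemma quadrant_newton_polyhedron:
  assumes pq: "coeff2 f p q \<noteq> 0"
    and least: "\<And>i j. coeff2 f i j \<noteq> 0 \<Longrightarrow> p \<le> i \<and> q \<le> j"
  shows "quadrant (newton_polyhedron f)"
proof -
  define S where "S = {(real (i + u), real (j + v)) | i j u v. coeff2 f i j \<noteq> 0}"
  define v0 where "v0 = (real p, real q)"
  have P: "newton_polyhedron f = convex hull S" by (simp add: newton_polyhedron_def S_def)
  have S: "(real (p + u), real (q + v)) \<in> S" for u v
    using pq unfolding S_def by blast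
  have "S \<subseteq> {real p..} \<times> {real q..}"
    unfolding S_def using least by (fastforce simp: of_nat_le_iff[symmetric] simp del: of_nat_le_iff)
  then have sub: "convex hull S \<subseteq> {real p..} \<times> {real q..}"
    by (intro hull_minimal convex_Times) auto
  have "v0 extreme_point_of (convex hull S)"
    unfolding extreme_point_of_def
  proof (intro conjI ballI notI)
    show "v0 \<in> convex hull S" using S[of 0 0] by (simp add: v0_def hull_inc)
  next
    fix a b assume ab: "a \<in> convex hull S" "b \<in> convex hull S" and v0: "v0 \<in> open_segment a b"
    obtain a1 a2 b1 b2 where [simp]: "a = (a1, a2)" "b = (b1, b2)" by (cases a, cases b)
    have ge: "real p \<le> a1" "real q \<le> a2" "real p \<le> b1" "real q \<le> b2"
      using ab sub by auto
    obtain u where u: "0 < u" "u < 1" and "a \<noteq> b"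
      and eq: "v0 = (1 - u) *\<^sub>R a + u *\<^sub>R b"
      using v0 by (auto simp: in_segment)
    have zero: "x = c \<and> y = c" if "c = (1 - u) * x + u * y" "c \<le> x" "c \<le> y" for c x y :: real
    proof -
      have "(1 - u) * (x - c) + u * (y - c) = 0" using that by (simp add: algebra_simps)
      moreover have "0 \<le> (1 - u) * (x - c)" "0 \<le> u * (y - c)" using that u by auto
      ultimately have "(1 - u) * (x - c) = 0" "u * (y - c) = 0" by linarith+
      then show ?thesis using u by simp
    qed
    have "a1 = real p \<and> b1 = real p" "a2 = real q \<and> b2 = real q"
      using zero[of "real p" a1 b1] zero[of "real q" a2 b2] eq ge by (auto simp: v0_def)
    with \<open>a \<noteq> b\<close> show False by simp
  qed
  moreover have "v = v0" if v: "v extreme_point_of (convex hull S)" for v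
  proof (rule ccontr)
    assume "v \<noteq> v0"
    have "v \<in> S" using v by (rule extreme_point_of_convex_hull)
    then obtain i j u w where c: "coeff2 f i j \<noteq> 0" and vv: "v = (real (i + u), real (j + w))"
      unfolding S_def by blast
    define x y where "x = i + u - p" and "y = j + w - q"
    have xy: "v = (real (p + x), real (q + y))"
      using least[OF c] by (simp add: vv x_def y_def)
    have mid: "\<not> (a \<in> S \<and> b \<in> S \<and> a \<noteq> b \<and> v = (1/2) *\<^sub>R a + (1/2) *\<^sub>R b)" for a b
    proof
      assume "a \<in> S \<and> b \<in> S \<and> a \<noteq> b \<and> v = (1/2) *\<^sub>R a + (1/2) *\<^sub>R b"
      moreover from this have "v \<in> open_segment a b"
        unfolding in_segment by (intro conjI exI[of _ "1/2"]) auto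
      ultimately show False using v unfolding extreme_point_of_def by (meson hull_inc)
    qed
    show False
    proof (cases "x = 0")
      case True
      then obtain y' where "y = Suc y'" using \<open>v \<noteq> v0\<close> by (cases y) (auto simp: xy v0_def)
      then show False
        using mid[of "(real (p + x), real (q + y'))" "(real (p + x), real (q + (y' + 2)))"]
          S[of x y'] S[of x "y' + 2"]
        by (simp add: xy field_simps)
    next
      case False
      then obtain x' where "x = Suc x'" by (cases x) auto
      then show False
        using mid[of "(real (p + x'), real (q + y))" "(real (p + (x' + 2)), real (q + y))"]
          S[of x' y] S[of "x' + 2" y]
        by (simp add: xy field_simps)
    qed
  qed
  ultimately show ?thesis unfolding P quadrant_def by blast
qed

lemma quadrant_height_0:
  assumes "f \<noteq> 0" "height f = 0"
  shows "quadrant (newton_polyhedron f)"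
proof (rule quadrant_newton_polyhedron)
  have v: "left_vertex f (left_x f) (left_y f)"
    using assms(1) by (rule left_vertex_left_x_left_y)
  then show "coeff2 f (left_x f) (left_y f) \<noteq> 0" by (simp add: left_vertex_def)
  fix i j assume ij: "coeff2 f i j \<noteq> 0"
  then have "left_x f < i \<or> left_x f = i" using v unfolding left_vertex_def by blast
  then show "left_x f \<le> i \<and> left_y f \<le> j"
    using y_order_le[OF ij] assms(2) unfolding height_def by auto
qed


section \<open>Effect of the transformations on the left vertex\<close>

lemma monoidal_ZX_coeff: "f = X2 ^ e * f' \<Longrightarrow> coeff2 f i j = (if i < e then 0 else coeff2 f' (i - e) j)"
  for f :: "'a::comm_ring_1 ps2"
  by (simp only: coeff2_X2_power_mult)

lemma monoidal_ZY_coeff: "f = Y2 ^ e * f' \<Longrightarrow> coeff2 f i j = (if j < e then 0 else coeff2 f' i (j - e))"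
  for f :: "'a::comm_ring_1 ps2"
  by (simp only: coeff2_Y2_power_mult)

lemma quadratic_Y_coeff:
  fixes f :: "'a::comm_ring_1 ps2"
  assumes "subst2 f (X2 * Y2) Y2 = Y2 ^ e * f'"
  shows "coeff2 f i j \<noteq> 0 \<Longrightarrow> e \<le> i + j \<and> coeff2 f' i (i + j - e) \<noteq> 0"
    and "coeff2 f' i j \<noteq> 0 \<Longrightarrow> i \<le> j + e \<and> coeff2 f i (j + e - i) \<noteq> 0"
proof -
  have *: "(if p \<le> q then coeff2 f p (q - p) else 0) = (if q < e then 0 else coeff2 f' p (q - e))"
    for p q
    using coeff2_subst2_quadratic_Y[of f p q] unfolding assms coeff2_Y2_power_mult by simp
  show "coeff2 f i j \<noteq> 0 \<Longrightarrow> e \<le> i + j \<and> coeff2 f' i (i + j - e) \<noteq> 0"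
    using *[of i "i + j"] by (auto split: if_splits)
  show "coeff2 f' i j \<noteq> 0 \<Longrightarrow> i \<le> j + e \<and> coeff2 f i (j + e - i) \<noteq> 0"
    using *[of i "j + e"] by (auto split: if_splits)
qed

lemma quadratic_X_coeff:
  fixes f :: "'a::comm_ring_1 ps2"
  assumes "subst2 f X2 (X2 * (Y2 + const2 b)) = X2 ^ e * f'"
  shows "(\<Sum>j\<le>p. coeff2 f (p - j) j * (of_nat (j choose q) * b ^ (j - q)))
    = (if p < e then 0 else coeff2 f' (p - e) q)"
  using coeff2_subst2_quadratic_X[of f b p q] unfolding assms coeff2_X2_power_mult by simp

lemma quadratic_X_0_coeff:
  fixes f :: "'a::comm_ring_1 ps2"
  assumes "subst2 f X2 (X2 * Y2) = X2 ^ e * f'"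
  shows "coeff2 f i j \<noteq> 0 \<Longrightarrow> e \<le> i + j \<and> coeff2 f' (i + j - e) j \<noteq> 0"
    and "coeff2 f' i j \<noteq> 0 \<Longrightarrow> j \<le> i + e \<and> coeff2 f (i + e - j) j \<noteq> 0"
proof -
  have *: "(if q \<le> p then coeff2 f (p - q) q else 0) = (if p < e then 0 else coeff2 f' (p - e) q)"
    for p q
  proof -
    have "coeff2 f (p - j) j * (of_nat (j choose q) * 0 ^ (j - q))
        = (if j = q then coeff2 f (p - j) j else 0)" for j
      by (cases j q rule: linorder_cases) (simp_all add: binomial_eq_0 power_0_left)
    then show ?thesis
      using quadratic_X_coeff[of f 0 e f' p q] assms by simp
  qed
  show "coeff2 f i j \<noteq> 0 \<Longrightarrow> e \<le> i + j \<and> coeff2 f' (i + j - e) j \<noteq> 0"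
    using *[of j "i + j"] by (auto split: if_splits)
  show "coeff2 f' i j \<noteq> 0 \<Longrightarrow> j \<le> i + e \<and> coeff2 f (i + e - j) j \<noteq> 0"
    using *[of j "i + e"] by (auto split: if_splits)
qed


lemma height_monoidal_ZX:
  fixes f :: "'a::comm_ring_1 ps2"
  assumes eq: "f = X2 ^ e * f'" and f: "f \<noteq> 0"
  shows "left_x f = left_x f' + e" and "left_y f = left_y f'" and "y_order f = y_order f'"
proof -
  note c = monoidal_ZX_coeff[OF eq]
  have "f' \<noteq> 0" using f eq by auto
  then have "left_vertex f' (left_x f') (left_y f')" by (rule left_vertex_left_x_left_y)
  then have "left_vertex f (left_x f' + e) (left_y f')"
    by (force simp: left_vertex_def c)
  then show "left_x f = left_x f' + e" and "left_y f = left_y f'"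
    by (simp_all add: left_x_eq left_y_eq)
  have "(\<exists>i. coeff2 f i j \<noteq> 0) \<longleftrightarrow> (\<exists>i. coeff2 f' i j \<noteq> 0)" for j
  proof
    assume "\<exists>i. coeff2 f i j \<noteq> 0"
    then show "\<exists>i. coeff2 f' i j \<noteq> 0" by (auto simp: c split: if_splits)
  next
    assume "\<exists>i. coeff2 f' i j \<noteq> 0"
    then obtain i where "coeff2 f (i + e) j \<noteq> 0" by (auto simp: c)
    then show "\<exists>i. coeff2 f i j \<noteq> 0" by blast
  qed
  then show "y_order f = y_order f'" by (simp add: y_order_def)
qed

lemma height_monoidal_ZY:
  fixes f :: "'a::comm_ring_1 ps2"
  assumes eq: "f = Y2 ^ e * f'" and f: "f \<noteq> 0"
  shows "left_y f = left_y f' + e" and "y_order f = y_order f' + e"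
proof -
  note c = monoidal_ZY_coeff[OF eq]
  have f': "f' \<noteq> 0" using f eq by auto
  then have "left_vertex f' (left_x f') (left_y f')" by (rule left_vertex_left_x_left_y)
  then have "left_vertex f (left_x f') (left_y f' + e)"
    by (force simp: left_vertex_def c)
  then show "left_y f = left_y f' + e" by (rule left_y_eq)
  show "y_order f = y_order f' + e"
  proof (rule antisym)
    obtain i where "coeff2 f' i (y_order f') \<noteq> 0" using y_order_attained[OF f'] by blast
    then show "y_order f \<le> y_order f' + e" by (intro y_order_le[of f i]) (simp add: c)
    obtain i where "coeff2 f i (y_order f) \<noteq> 0" using y_order_attained[OF f] by blast
    then have "e \<le> y_order f" "coeff2 f' i (y_order f - e) \<noteq> 0"
      unfolding c by (auto split: if_splits)
    then show "y_order f' + e \<le> y_order f" using y_order_le[of f' i] by fastforce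
  qed
qed

text \<open>
  \<open>X^i Y^j\<close> becomes \<open>X^i Y^(i+j-e)\<close>, so the left vertex \<open>(p, d)\<close> moves to \<open>(p, p+d-e)\<close>, and the lowest
  ordinate becomes \<open>m - e\<close> with \<open>m\<close> the order of the series. If \<open>Y^q\<close> is the highest power of \<open>Y\<close>
  dividing it, then \<open>m \<ge> p + q\<close>, with equality only if \<open>(p, q)\<close> is in the support, that is, if
  \<open>d = q\<close>.
\<close>

lemma height_quadratic_Y:
  fixes f :: "'a::comm_ring_1 ps2"
  assumes eq: "subst2 f (X2 * Y2) Y2 = Y2 ^ e * f'" and f: "f \<noteq> 0"
  shows "height f' \<le> height f" and "height f > 0 \<Longrightarrow> height f' < height f"
proof -
  note c = quadratic_Y_coeff[OF eq]
  have v: "left_vertex f (left_x f) (left_y f)" using f by (rule left_vertex_left_x_left_y)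
  then have e: "e \<le> left_x f + left_y f" and c': "coeff2 f' (left_x f) (left_x f + left_y f - e) \<noteq> 0"
    using c(1) unfolding left_vertex_def by blast+
  have f': "f' \<noteq> 0" using c' by auto
  have "left_vertex f' (left_x f) (left_x f + left_y f - e)"
    unfolding left_vertex_def
  proof (intro conjI allI impI)
    fix i j assume "coeff2 f' i j \<noteq> 0"
    from c(2)[OF this] have "i \<le> j + e" and "coeff2 f i (j + e - i) \<noteq> 0" by auto
    moreover from this(2) have "left_x f < i \<or> left_x f = i \<and> left_y f \<le> j + e - i"
      using v unfolding left_vertex_def by blast
    ultimately show "left_x f < i \<or> left_x f = i \<and> left_x f + left_y f - e \<le> j" by auto
  qed (rule c')
  then have y: "left_y f' = left_x f + left_y f - e" by (rule left_y_eq)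
  obtain i where "coeff2 f' i (y_order f') \<noteq> 0" using y_order_attained[OF f'] by blast
  from c(2)[OF this] have i: "i \<le> y_order f' + e" and ci: "coeff2 f i (y_order f' + e - i) \<noteq> 0"
    by auto
  from y_order_le[OF ci] have yi: "y_order f \<le> y_order f' + e - i" .
  have xi: "left_x f < i \<or> left_x f = i \<and> left_y f \<le> y_order f' + e - i"
    using v ci unfolding left_vertex_def by blast
  show "height f' \<le> height f"
    unfolding height_def y using xi yi i e by auto
  show "height f' < height f" if "height f > 0"
    using that unfolding height_def y using xi yi i e by auto
qed

text \<open>
  A polynomial of degree \<open>J\<close> divisible by \<open>Y^q\<close> has at \<open>b \<noteq> 0\<close> a root of multiplicity at most \<open>J - q\<close>.
\<close>

lemma translated_polynomial_low_coeff:
  fixes c :: "nat \<Rightarrow> 'a::field"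
  assumes "b \<noteq> 0" and low: "\<And>j. j < q \<Longrightarrow> c j = 0" and high: "\<And>j. J < j \<Longrightarrow> j \<le> M \<Longrightarrow> c j = 0"
    and J: "c J \<noteq> 0" "J \<le> M"
  shows "\<exists>r\<le>J - q. (\<Sum>j\<le>M. c j * (of_nat (j choose r) * b ^ (j - r))) \<noteq> 0"
proof -
  let ?L = "fps_X + fps_const b"
  (* The factor of degree q becomes a unit in the power series ring at the point b. *)
  define \<phi> where "\<phi> = (\<Sum>j\<le>M. fps_const (c j) * ?L ^ j)"
  define \<psi> where "\<psi> = (\<Sum>j\<le>M. fps_const (c j) * ?L ^ (j - q))"
  have q: "q \<le> J" using low[of J] J by force
  have "fps_const (c j) * ?L ^ j = ?L ^ q * (fps_const (c j) * ?L ^ (j - q))" for j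
  proof (cases "j < q")
    case False
    then have "?L ^ j = ?L ^ q * ?L ^ (j - q)" by (simp flip: power_add)
    then show ?thesis by (simp only: mult_ac)
  qed (simp add: low)
  then have \<phi>: "\<phi> = ?L ^ q * \<psi>"
    unfolding \<phi>_def \<psi>_def sum_distrib_left by (intro sum.cong refl)
  have "fps_nth \<psi> (J - q) = (\<Sum>j\<le>M. c j * (of_nat (j - q choose (J - q)) * b ^ (j - q - (J - q))))"
    unfolding \<psi>_def fps_sum_nth fps_mult_left_const_nth fps_X_plus_const_power_nth ..
  also have "\<dots> = (\<Sum>j\<in>{J}. c j * (of_nat (j - q choose (J - q)) * b ^ (j - q - (J - q))))"
  proof (rule sum.mono_neutral_right)
    show "\<forall>j\<in>{..M} - {J}. c j * (of_nat (j - q choose (J - q)) * b ^ (j - q - (J - q))) = 0"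
    proof
      fix j assume "j \<in> {..M} - {J}"
      then consider "j < q" | "q \<le> j" "j < J" | "J < j" "j \<le> M" by force
      then show "c j * (of_nat (j - q choose (J - q)) * b ^ (j - q - (J - q))) = 0"
        by cases (simp_all add: low high binomial_eq_0)
    qed
  qed (use J in auto)
  finally have \<psi>: "fps_nth \<psi> (J - q) \<noteq> 0" using J by simp
  then have "\<psi> \<noteq> 0" by auto
  have L: "fps_nth ?L 0 \<noteq> 0" using \<open>b \<noteq> 0\<close> by simp
  then have "?L ^ q \<noteq> 0" "subdegree (?L ^ q) = 0"
    by (auto simp: fps_power_zeroth intro!: subdegree_eq_0)
  with \<open>\<psi> \<noteq> 0\<close> have "\<phi> \<noteq> 0" "subdegree \<phi> = subdegree \<psi>"
    unfolding \<phi> by (simp_all only: subdegree_mult mult_eq_0_iff) auto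
  from \<open>\<phi> \<noteq> 0\<close> have "fps_nth \<phi> (subdegree \<phi>) \<noteq> 0" by (rule nth_subdegree_nonzero)
  moreover have "subdegree \<phi> \<le> J - q"
    unfolding \<open>subdegree \<phi> = subdegree \<psi>\<close> using \<psi> by (rule subdegree_leI)
  moreover have "fps_nth \<phi> r = (\<Sum>j\<le>M. c j * (of_nat (j choose r) * b ^ (j - r)))" for r
    unfolding \<phi>_def fps_sum_nth fps_mult_left_const_nth fps_X_plus_const_power_nth ..
  ultimately show ?thesis by auto
qed

text \<open>
  Let \<open>M\<close> be the order of \<open>f\<close> and \<open>J\<close> the largest exponent of \<open>Y\<close> in its initial form. The coefficient
  of \<open>X^(M-e)\<close> in \<open>f'\<close> is the dehomogenized initial form, translated by \<open>b\<close>, and \<open>M - e\<close> is the new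
  abscissa. So the new ordinate is at most the degree \<open>J\<close>, and \<open>J \<le> d\<close> because the left vertex \<open>(p, d)\<close> of \<open>f\<close>
  satisfies \<open>M \<le> p + d\<close>. If the ordinate does not change, then \<open>J = d\<close>, which forces \<open>M = p + d\<close>.
  For \<open>b \<noteq> 0\<close> the power of \<open>Y\<close> dividing \<open>f\<close> may get lost, but then the ordinate drops by as much.
\<close>

lemma height_quadratic_X:
  fixes f :: "'a::field ps2"
  assumes eq: "subst2 f X2 (X2 * (Y2 + const2 b)) = X2 ^ e * f'" and f: "f \<noteq> 0"
  shows "left_y f' \<le> left_y f" and "height f' \<le> height f"
    and "left_y f' = left_y f \<Longrightarrow> left_x f' + e = left_x f + left_y f"
proof -
  note c = quadratic_X_coeff[OF eq]
  have v: "left_vertex f (left_x f) (left_y f)" using f by (rule left_vertex_left_x_left_y)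
  define M where "M = (LEAST m. \<exists>i j. m = i + j \<and> coeff2 f i j \<noteq> 0)"
  have ex: "\<exists>m i j. m = i + j \<and> coeff2 f i j \<noteq> 0" using f unfolding ps2_nonzero_iff by blast
  have "\<exists>i j. M = i + j \<and> coeff2 f i j \<noteq> 0" unfolding M_def by (rule LeastI_ex[OF ex])
  then obtain i0 j0 where "M = i0 + j0" "coeff2 f i0 j0 \<noteq> 0" by blast
  then have j0: "j0 \<le> M" "coeff2 f (M - j0) j0 \<noteq> 0" by simp_all
  have M_le: "M \<le> i + j" if "coeff2 f i j \<noteq> 0" for i j
    unfolding M_def using that by (intro Least_le) blast
  define J where "J = (GREATEST j. j \<le> M \<and> coeff2 f (M - j) j \<noteq> 0)"
  have J: "J \<le> M" "coeff2 f (M - J) J \<noteq> 0"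
    using GreatestI_nat[of "\<lambda>j. j \<le> M \<and> coeff2 f (M - j) j \<noteq> 0" j0 M] j0
    unfolding J_def by auto
  have J_max: "coeff2 f (M - j) j = 0" if "J < j" "j \<le> M" for j
    using Greatest_le_nat[of "\<lambda>j. j \<le> M \<and> coeff2 f (M - j) j \<noteq> 0" j M] that
    unfolding J_def by (meson not_le)
  have M_left: "M \<le> left_x f + left_y f"
    using v M_le unfolding left_vertex_def by blast
  have J_left: "left_x f < M - J \<or> left_x f = M - J \<and> left_y f \<le> J"
    using v J unfolding left_vertex_def by blast
  have J_le: "J \<le> left_y f"
    using M_left J_left J(1) v J_max unfolding left_vertex_def by linarith
  have "(\<Sum>j\<le>M. coeff2 f (M - j) j * (of_nat (j choose J) * b ^ (j - J)))
      = (\<Sum>j\<in>{J}. coeff2 f (M - j) j * (of_nat (j choose J) * b ^ (j - J)))"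
  proof (rule sum.mono_neutral_right)
    show "\<forall>j\<in>{..M} - {J}. coeff2 f (M - j) j * (of_nat (j choose J) * b ^ (j - J)) = 0"
    proof
      fix j assume "j \<in> {..M} - {J}"
      then consider "j < J" | "J < j" "j \<le> M" by force
      then show "coeff2 f (M - j) j * (of_nat (j choose J) * b ^ (j - J)) = 0"
        by cases (simp_all add: J_max binomial_eq_0)
    qed
  qed (use J in auto)
  with J(2) have "(if M < e then 0 else coeff2 f' (M - e) J) \<noteq> 0"
    unfolding c by simp
  then have e: "e \<le> M" and c'J: "coeff2 f' (M - e) J \<noteq> 0" by (auto split: if_splits)
  have f': "f' \<noteq> 0" using c'J by auto
  then have v': "left_vertex f' (left_x f') (left_y f')" by (rule left_vertex_left_x_left_y)
  have "M - e \<le> i" if "coeff2 f' i j \<noteq> 0" for i j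
  proof (rule ccontr)
    assume "\<not> M - e \<le> i"
    then have "coeff2 f (i + e - l) l = 0" if "l \<le> i + e" for l
      using M_le[of "i + e - l" l] that by fastforce
    then have "coeff2 f' i j = 0" using c[of "i + e" j] by simp
    with that show False by simp
  qed
  then have x': "left_x f' = M - e"
    using v' c'J unfolding left_vertex_def by (metis le_antisym less_imp_le order_refl)
  have y'_le: "left_y f' \<le> j" if "coeff2 f' (M - e) j \<noteq> 0" for j
    using v' that x' unfolding left_vertex_def by auto
  have y'_J: "left_y f' \<le> J" by (rule y'_le[OF c'J])
  show "left_y f' \<le> left_y f" using y'_J J_le by simp
  show "left_x f' + e = left_x f + left_y f" if "left_y f' = left_y f"
    using that y'_J J_le x' e M_left J_left J(1) by linarith
  show "height f' \<le> height f"
  proof (cases "b = 0")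
    case True
    then have "subst2 f X2 (X2 * Y2) = X2 ^ e * f'" using eq by simp
    note c0 = quadratic_X_0_coeff[OF this]
    obtain i where "coeff2 f' i (y_order f') \<noteq> 0" using y_order_attained[OF f'] by blast
    from c0(2)[OF this] have "y_order f \<le> y_order f'" using y_order_le by blast
    then show ?thesis unfolding height_def using y'_J J_le by linarith
  next
    case False
    have "coeff2 f (M - j) j = 0" if "j < y_order f" for j
      using y_order_le[of f "M - j" j] that by fastforce
    from translated_polynomial_low_coeff[where c = "\<lambda>j. coeff2 f (M - j) j", OF False this J_max J(2,1)]
    obtain r where "r \<le> J - y_order f"
      "(\<Sum>j\<le>M. coeff2 f (M - j) j * (of_nat (j choose r) * b ^ (j - r))) \<noteq> 0" by blast
    then have "left_y f' \<le> J - y_order f"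
      using y'_le[of r] e unfolding c by auto
    then show ?thesis unfolding height_def using J_le by linarith
  qed
qed


section \<open>The limit curve\<close>

text \<open>
  \<open>Q t\<close> says that step \<open>t\<close> is quadratic, with translation \<open>b t\<close>. For \<open>r > 0\<close>, the coefficient of \<open>X^r\<close> in the limit
  curve at time \<open>t\<close> is the translation of the \<open>r\<close>-th quadratic step from \<open>t\<close> on.
\<close>

primrec tail_coeff :: "(nat \<Rightarrow> bool) \<Rightarrow> (nat \<Rightarrow> 'a::zero) \<Rightarrow> nat \<Rightarrow> nat \<Rightarrow> 'a" where
  "tail_coeff Q b 0 t = 0"
| "tail_coeff Q b (Suc r) t = (let s = (LEAST s. t \<le> s \<and> Q s) in
     if r = 0 then b s else tail_coeff Q b r (Suc s))"

lemma exists_limit_curve: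
  fixes b :: "nat \<Rightarrow> 'a::comm_ring_1"
  shows "\<exists>h. \<forall>t. fps_nth (h t) 0 = 0 \<and>
    h t = (if Q t then fps_X * (fps_const (b t) + h (Suc t)) else h (Suc t))"
proof (intro exI allI conjI)
  fix t
  show "fps_nth (Abs_fps (\<lambda>r. tail_coeff Q b r t)) 0 = 0" by simp
  show "Abs_fps (\<lambda>r. tail_coeff Q b r t) = (if Q t
      then fps_X * (fps_const (b t) + Abs_fps (\<lambda>r. tail_coeff Q b r (Suc t)))
      else Abs_fps (\<lambda>r. tail_coeff Q b r (Suc t)))" (is "?L = ?R")
  proof (rule fps_ext)
    fix r
    show "fps_nth ?L r = fps_nth ?R r"
    proof (cases "Q t")
      case True
      then have "(LEAST s. t \<le> s \<and> Q s) = t" by (intro Least_equality) auto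
      then show ?thesis using True by (cases r) (auto simp: Let_def)
    next
      case False
      then have "(\<lambda>s. t \<le> s \<and> Q s) = (\<lambda>s. Suc t \<le> s \<and> Q s)"
        by (auto simp: fun_eq_iff Suc_le_eq le_less)
      then show ?thesis using False by (cases r) (simp_all add: Let_def)
    qed
  qed
qed

lemma nat_seq_eventually_constant:
  fixes a :: "nat \<Rightarrow> nat"
  assumes "\<And>t. t \<ge> M0 \<Longrightarrow> a (Suc t) \<le> a t"
  shows "\<exists>M\<ge>M0. \<forall>t\<ge>M. a t = a M"
proof -
  define m where "m = (LEAST m. \<exists>t\<ge>M0. a t = m)"
  have "\<exists>t\<ge>M0. a t = m" unfolding m_def by (rule LeastI_ex) blast
  then obtain M where M: "M \<ge> M0" "a M = m" by blast
  have "a t \<le> m" if "t \<ge> M" for t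
    using that
  proof (induction t rule: dec_induct)
    case (step t)
    then show ?case using assms[of t] M by simp
  qed (simp add: M)
  moreover have "m \<le> a t" if "t \<ge> M" for t
    unfolding m_def using that M by (intro Least_le exI[of _ t]) auto
  ultimately show ?thesis using M by (metis le_antisym)
qed

text \<open>
  Modulo \<open>X\<close> the transvection is the identity, so after division of \<open>f\<close> by \<open>X^p\<close> the terms
  free of \<open>X\<close>, which determine the vertex, do not change.
\<close>

lemma left_vertex_shear:
  fixes f :: "'a::comm_ring_1 ps2"
  assumes h: "fps_nth h 0 = 0" and v: "left_vertex f p d"
  shows "left_vertex (subst2 f X2 (Y2 + fps_const h)) p d"
proof -
  let ?B = "Y2 + fps_const h"
  have B: "order_ge 1 ?B" using h by (simp add: order_ge_def coeff2_def)
  have low: "coeff2 f i j = 0" if "i < p" for i j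
    using v that unfolding left_vertex_def by (metis less_asym less_irrefl)
  define f0 where "f0 = Abs_ps2 (\<lambda>i j. coeff2 f (i + p) j)"
  have f: "f = X2 ^ p * f0"
    by (rule ps2_eqI) (simp only: coeff2_X2_power_mult f0_def coeff2_Abs_ps2, auto simp: low)
  have g: "subst2 f X2 ?B = X2 ^ p * subst2 f0 X2 ?B"
    unfolding f fps_const_power by (rule subst2_X_const_mult[OF B])
  have "coeff2 (subst2 f0 X2 ?B) 0 j = coeff2 f0 0 j" for j
  proof -
    have t: "coeff2 (fps_const (fps_nth f0 l) * ?B ^ l) 0 j = (if l = j then coeff2 f0 0 j else 0)" for l
    proof -
      have "coeff2 (fps_const (fps_nth f0 l) * ?B ^ l) 0 j
          = fps_nth (fps_nth f0 l * (of_nat (l choose j) * h ^ (l - j))) 0"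
        unfolding coeff2_def fps_mult_left_const_nth fps_X_plus_const_power_nth ..
      also have "\<dots> = fps_nth (fps_nth f0 l) 0 * (of_nat (l choose j) * 0 ^ (l - j))"
        by (simp add: h fps_power_zeroth)
      finally show ?thesis
        by (cases l j rule: linorder_cases) (simp_all add: coeff2_def binomial_eq_0 power_0_left)
    qed
    have "coeff2 (subst2 f0 X2 ?B) 0 j = coeff2 (\<Sum>l<Suc j. fps_const (fps_nth f0 l) * ?B ^ l) 0 j"
      by (rule cong_orderD[OF subst2_X_cong_order[OF B]]) simp
    then show ?thesis unfolding coeff2_sum t by simp
  qed
  have eq: "coeff2 (subst2 f X2 ?B) i j = coeff2 f i j" if "i \<le> p" for i j
  proof -
    have "coeff2 f i j = (if i < p then 0 else coeff2 f0 (i - p) j)"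
      by (simp only: f coeff2_X2_power_mult)
    moreover have "coeff2 (subst2 f X2 ?B) i j
        = (if i < p then 0 else coeff2 (subst2 f0 X2 ?B) (i - p) j)"
      by (simp only: g coeff2_X2_power_mult)
    ultimately show ?thesis using that \<open>\<And>j. coeff2 (subst2 f0 X2 ?B) 0 j = coeff2 f0 0 j\<close>
      by (cases "i = p") simp_all
  qed
  show ?thesis
    unfolding left_vertex_def
  proof (intro conjI allI impI)
    show "coeff2 (subst2 f X2 ?B) p d \<noteq> 0" using v by (simp add: eq left_vertex_def)
    fix i j assume "coeff2 (subst2 f X2 ?B) i j \<noteq> 0"
    then have "p < i \<or> coeff2 f i j \<noteq> 0" using eq[of i j] by fastforce
    then show "p < i \<or> p = i \<and> d \<le> j"
      using v unfolding left_vertex_def by blast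
  qed
qed

text \<open>
  In the coordinate \<open>Y - h_t\<close> the quadratic steps have translation \<open>0\<close>, so all steps are monomial
  and the support in a fixed row \<open>j\<close> can be followed. For \<open>j < d\<close> its distance from the
  left vertex decreases in every quadratic step, which happens infinitely often.
\<close>

lemma generalized_quadrant_constant_left_y:
  fixes g :: "nat \<Rightarrow> 'a::field ps2"
  assumes e: "e > 0" and nz: "\<And>t. g t \<noteq> 0" and d: "\<And>t. left_y (g t) = d"
    and step: "\<And>t. (\<exists>b. subst2 (g t) X2 (X2 * (Y2 + const2 b)) = X2 ^ e * g (Suc t)) \<or>
      g t = X2 ^ e * g (Suc t)"
  shows "\<exists>h. fps_nth h 0 = 0 \<and> quadrant (newton_polyhedron (subst2 (g 0) X2 (Y2 + fps_const h)))"
proof -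
  define Q where "Q t \<longleftrightarrow> (\<exists>b. subst2 (g t) X2 (X2 * (Y2 + const2 b)) = X2 ^ e * g (Suc t))" for t
  define b where "b t = (SOME b. subst2 (g t) X2 (X2 * (Y2 + const2 b)) = X2 ^ e * g (Suc t))" for t
  have quad: "subst2 (g t) X2 (X2 * (Y2 + const2 (b t))) = X2 ^ e * g (Suc t)" if "Q t" for t
    using that unfolding Q_def b_def by (rule someI_ex)
  have mono: "g t = X2 ^ e * g (Suc t)" if "\<not> Q t" for t
    using step[of t] that unfolding Q_def by blast
  have x_quad: "left_x (g (Suc t)) + e = left_x (g t) + d" if "Q t" for t
    using height_quadratic_X(3)[OF quad[OF that] nz] d by simp
  have x_mono: "left_x (g (Suc t)) + e = left_x (g t)" if "\<not> Q t" for t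
    using height_monoidal_ZX(1)[OF mono[OF that] nz] by simp
  have inf: "\<exists>s\<ge>t. Q s" for t
  proof (rule ccontr)
    assume "\<not> (\<exists>s\<ge>t. Q s)"
    then have less: "left_x (g (Suc s)) < left_x (g s)" if "s \<ge> t" for s
      using x_mono[of s] that e by force
    then have "\<exists>M\<ge>t. \<forall>s\<ge>M. left_x (g s) = left_x (g M)"
      by (intro nat_seq_eventually_constant less_imp_le)
    then obtain M where "M \<ge> t" and M: "\<forall>s\<ge>M. left_x (g s) = left_x (g M)" by blast
    show False using less[OF \<open>M \<ge> t\<close>] M[rule_format, of "Suc M"] by simp
  qed
  obtain h where h0: "\<And>t. fps_nth (h t) 0 = 0"
    and h: "\<And>t. h t = (if Q t then fps_X * (fps_const (b t) + h (Suc t)) else h (Suc t))"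
    using exists_limit_curve[of Q b] by blast
  define G where "G t = subst2 (g t) X2 (Y2 + fps_const (h t))" for t
  have Yh: "order_ge 1 (Y2 + fps_const (h t))" for t
    using h0[of t] by (simp add: order_ge_def coeff2_def)
  have G_mult: "subst2 (X2 ^ e * f) X2 (Y2 + fps_const (h t)) = X2 ^ e * subst2 f X2 (Y2 + fps_const (h t))"
    for f t
    unfolding fps_const_power by (rule subst2_X_const_mult[OF Yh])
  (* Both sides are g t with Y replaced by X Y + h t. *)
  have G_quad: "subst2 (G t) X2 (X2 * Y2) = X2 ^ e * G (Suc t)" if "Q t" for t
  proof -
    have XY: "order_ge 1 (X2 * Y2 :: 'a ps2)" by (simp add: order_ge_def coeff2_def)
    have "G t = subst2 (g t) X2 (fps_const (h t) + fps_const 1 * Y2)"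
      unfolding G_def by (simp add: add.commute)
    then have "subst2 (G t) X2 (X2 * Y2) = subst2 (g t) X2 (fps_const (h t) + fps_const 1 * (X2 * Y2))"
      by (simp only: subst2_X_compose[OF h0 XY])
    also have "fps_const (h t) + fps_const 1 * (X2 * Y2)
        = fps_const (fps_X * fps_const (b t)) + fps_const fps_X * (Y2 + fps_const (h (Suc t)))"
      using h[of t] that by (simp add: algebra_simps flip: fps_const_mult fps_const_add)
    also have "subst2 (g t) X2 \<dots> = subst2 (subst2 (g t) X2
        (fps_const (fps_X * fps_const (b t)) + fps_const fps_X * Y2)) X2 (Y2 + fps_const (h (Suc t)))"
      by (rule subst2_X_compose[symmetric]) (simp_all only: Yh, simp)
    also have "fps_const (fps_X * fps_const (b t)) + fps_const fps_X * Y2 = X2 * (Y2 + const2 (b t))"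
      by (simp add: algebra_simps flip: fps_const_mult)
    finally show ?thesis
      by (simp only: quad[OF that] G_mult G_def)
  qed
  have G_mono: "G t = X2 ^ e * G (Suc t)" if "\<not> Q t" for t
    unfolding G_def using mono[OF that] h[of t] that G_mult by metis
  have G_v: "left_vertex (G t) (left_x (g t)) d" for t
    unfolding G_def using left_vertex_shear[OF h0 left_vertex_left_x_left_y[OF nz]] d by metis
  have "d \<le> j" if "coeff2 (G 0) i j \<noteq> 0" for i j
  proof (rule ccontr)
    assume "\<not> d \<le> j"
    have quad_coeff: "e \<le> i + j \<and> coeff2 (G (Suc t)) (i + j - e) j \<noteq> 0"
      if "Q t" "coeff2 (G t) i j \<noteq> 0" for t i
      using quadratic_X_0_coeff(1)[OF G_quad[OF that(1)] that(2)] .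
    have mono_coeff: "e \<le> i \<and> coeff2 (G (Suc t)) (i - e) j \<noteq> 0"
      if "\<not> Q t" "coeff2 (G t) i j \<noteq> 0" for t i
      using that(2) unfolding monoidal_ZX_coeff[OF G_mono[OF that(1)]] by (auto split: if_splits)
    define m where "m t = (LEAST i. coeff2 (G t) i j \<noteq> 0)" for t
    have ex: "\<exists>i. coeff2 (G t) i j \<noteq> 0" for t
    proof (induction t)
      case 0
      show ?case using that by blast
    next
      case (Suc t)
      then show ?case using quad_coeff[of t] mono_coeff[of t] by blast
    qed
    have m: "coeff2 (G t) (m t) j \<noteq> 0" for t
      unfolding m_def using ex by (rule LeastI_ex)
    have m_le: "m t \<le> i" if "coeff2 (G t) i j \<noteq> 0" for t i
      unfolding m_def using that by (rule Least_le)
    have x_le: "left_x (g t) \<le> m t" for t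
      using left_vertex_le[OF G_v m] .
    (* Horizontal distance between row j of the support and the left vertex. *)
    define a where "a t = m t - left_x (g t)" for t
    have a_quad: "a (Suc t) < a t" if "Q t" for t
    proof -
      have "e \<le> m t + j" "m (Suc t) \<le> m t + j - e"
        using quad_coeff[OF that m] m_le by blast+
      then show ?thesis
        using x_quad[OF that] x_le[of t] x_le[of "Suc t"] \<open>\<not> d \<le> j\<close> unfolding a_def by linarith
    qed
    have a_mono: "a (Suc t) \<le> a t" if "\<not> Q t" for t
    proof -
      have "e \<le> m t" "m (Suc t) \<le> m t - e"
        using mono_coeff[OF that m] m_le by blast+
      then show ?thesis
        using x_mono[OF that] x_le[of t] x_le[of "Suc t"] unfolding a_def by linarith
    qed
    have "a (Suc t) \<le> a t" for t
      using a_quad[of t] a_mono[of t] by linarith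
    then obtain M where M: "\<forall>t\<ge>M. a t = a M"
      using nat_seq_eventually_constant[of 0 a] by blast
    obtain s where "s \<ge> M" "Q s" using inf by blast
    with a_quad[of s] M show False by (metis le_SucI less_irrefl)
  qed
  moreover have "coeff2 (G 0) (left_x (g 0)) d \<noteq> 0"
    using G_v[of 0] unfolding left_vertex_def by blast
  ultimately have "quadrant (newton_polyhedron (G 0))"
    using left_vertex_le[OF G_v[of 0]] by (intro quadrant_newton_polyhedron conjI)
  then show ?thesis using h0 unfolding G_def by blast
qed

text \<open>
  Either the height reaches \<open>0\<close>, where it stays, or the ordinate of the left vertex becomes constant.
  The conclusion holds for all late times, so that finitely many values of \<open>k\<close> can be
  treated simultaneously.
\<close>

lemma eventually_generalized_quadrant:
  fixes g :: "nat \<Rightarrow> 'a::field ps2"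
  assumes e: "e > 0" and step: "\<And>t. coeff_transformation e (g t) (g (Suc t))"
  shows "\<exists>M. \<forall>t\<ge>M. \<exists>h. fps_nth h 0 = 0 \<and>
    quadrant (newton_polyhedron (subst2 (g t) X2 (Y2 + fps_const h)))"
proof (cases "\<exists>t. g t = 0")
  case True
  then obtain M where M: "g M = 0" by blast
  have "g t = 0" if "t \<ge> M" for t
    using that
  proof (induction t rule: dec_induct)
    case (step t)
    with assms(2)[of t] show ?case by (auto elim: coeff_transformation.cases)
  qed (rule M)
  then show ?thesis
    by (intro exI[of _ M] allI impI exI[of _ 0]) (simp add: newton_polyhedron_def quadrant_def)
next
  case False
  then have nz: "\<And>t. g t \<noteq> 0" by blast
  define quad_Y where "quad_Y t \<longleftrightarrow> subst2 (g t) (X2 * Y2) Y2 = Y2 ^ e * g (Suc t)" for t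
  have cases: "quad_Y t \<or> (\<exists>b. subst2 (g t) X2 (X2 * (Y2 + const2 b)) = X2 ^ e * g (Suc t)) \<or>
      g t = X2 ^ e * g (Suc t) \<or> g t = Y2 ^ e * g (Suc t)" for t
    using step[of t] unfolding quad_Y_def by (auto elim: coeff_transformation.cases)
  show ?thesis
  proof (cases "\<forall>t. \<exists>s\<ge>t. quad_Y s")
    case True
    have "height (g (Suc t)) \<le> height (g t)" for t
      using step[of t]
    proof cases
      case (quadratic_X b)
      then show ?thesis using height_quadratic_X(2) nz by blast
    next
      case quadratic_Y
      then show ?thesis using height_quadratic_Y(1) nz by blast
    next
      case monoidal_ZX
      then show ?thesis using height_monoidal_ZX(2,3)[OF monoidal_ZX nz] by (simp add: height_def)
    next
      case monoidal_ZY
      then show ?thesis using height_monoidal_ZY[OF monoidal_ZY nz] by (simp add: height_def)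
    qed
    then obtain M where M: "\<And>t. t \<ge> M \<Longrightarrow> height (g t) = height (g M)"
      using nat_seq_eventually_constant[of 0 "\<lambda>t. height (g t)"] by blast
    obtain s where s: "s \<ge> M" "quad_Y s" using True by blast
    have "height (g (Suc s)) = height (g s)" using M[of s] M[of "Suc s"] s(1) by simp
    then have "height (g s) = 0"
      using height_quadratic_Y(2)[OF s(2)[unfolded quad_Y_def] nz] by (cases "height (g s)") auto
    then have "height (g t) = 0" if "t \<ge> M" for t using M[OF s(1)] M[OF that] by simp
    then show ?thesis
      using quadrant_height_0[OF nz]
      by (intro exI[of _ M] allI impI exI[of _ 0]) (simp add: subst2_X_Y)
  next
    case False
    then obtain M0 where "\<And>t. t \<ge> M0 \<Longrightarrow> \<not> quad_Y t" by blast
    then have cases: "(\<exists>b. subst2 (g t) X2 (X2 * (Y2 + const2 b)) = X2 ^ e * g (Suc t)) \<or>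
      g t = X2 ^ e * g (Suc t) \<or> g t = Y2 ^ e * g (Suc t)" if "t \<ge> M0" for t
      using cases[of t] that by blast
    have ZY: "left_y (g (Suc t)) < left_y (g t)" if "g t = Y2 ^ e * g (Suc t)" for t
      using height_monoidal_ZY(1)[OF that nz] e by simp
    have "left_y (g (Suc t)) \<le> left_y (g t)" if "t \<ge> M0" for t
      using cases[OF that] height_quadratic_X(1)[OF _ nz] height_monoidal_ZX(2)[OF _ nz] ZY
      by (metis less_imp_le order_refl)
    then obtain M where M: "M \<ge> M0" and const: "\<And>t. t \<ge> M \<Longrightarrow> left_y (g t) = left_y (g M)"
      using nat_seq_eventually_constant[of M0 "\<lambda>t. left_y (g t)"] by blast
    have "\<exists>h. fps_nth h 0 = 0 \<and> quadrant (newton_polyhedron (subst2 (g t) X2 (Y2 + fps_const h)))"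
      if t: "t \<ge> M" for t
    proof -
      have const_t: "left_y (g (s + t)) = left_y (g M)" for s
        using const[of "s + t"] t by simp
      have "(\<exists>b. subst2 (g (s + t)) X2 (X2 * (Y2 + const2 b)) = X2 ^ e * g (Suc s + t)) \<or>
          g (s + t) = X2 ^ e * g (Suc s + t)" for s
        using cases[of "s + t"] ZY[of "s + t"] const_t[of s] const_t[of "Suc s"] t M by auto
      from generalized_quadrant_constant_left_y[of e "\<lambda>s. g (s + t)", OF e nz const_t this]
      show ?thesis by simp
    qed
    then show ?thesis by blast
  qed
qed

theorem proposition4:
  fixes F :: "'a::{alg_closed_field, field_char_0} ps3"
    and n :: nat
    and S :: "nat \<Rightarrow> 'a ps3"
  assumes "n \<ge> 2"
    and "WT_equation n F"
    and "initial_form F = varZ ^ n"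
    and "S 0 = F"
    and "\<And>m. ord3 (S m) = enat n"
    and "\<And>m. algorithm_step n (S m) (S (Suc m))"
  shows "\<exists>m. WT_equation n (S m) \<and> (\<forall>k\<le>n - 2. generalized_quadrant k (S m))"
proof -
  have WT: "WT_equation n (S m)" for m
    using assms(1,2,4-6) algorithm_step_coeff_transformation by (induction m) blast+
  have "\<exists>M. \<forall>t\<ge>M. generalized_quadrant k (S t)" if "k \<le> n - 2" for k
  proof -
    have "coeff_transformation (n - k) (fps_nth (S t) k) (fps_nth (S (Suc t)) k)" for t
      using algorithm_step_coeff_transformation[OF assms(1) WT assms(5) assms(6)] that by simp
    moreover have "n - k > 0" using that assms(1) by simp
    ultimately show ?thesis
      using eventually_generalized_quadrant[of "n - k" "\<lambda>t. fps_nth (S t) k"]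
      unfolding generalized_quadrant_def Gam_def coeff_Z_transvection by blast
  qed
  then obtain M where M: "\<And>k t. k \<le> n - 2 \<Longrightarrow> t \<ge> M k \<Longrightarrow> generalized_quadrant k (S t)" by metis
  have "M k \<le> Max (M ` {..n - 2})" if "k \<le> n - 2" for k
    using that by simp
  with M WT show ?thesis by blast
qed

end
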